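(* Let $\nu$ be a positive integer, let $r>0$ be real, let $q=e^{-\pi\sqrt r}$, let $k_r\in(0,1)$ be defined by $K\!\left(\sqrt{1-k_r^2}\right)/K(k_r)=\sqrt r$, and let $k'_r=\sqrt{1-k_r^2}$. Then $$-1+\cfrac{2}{1-\cfrac{2q^{\nu}}{1-q+\cfrac{q^{2\nu}(1+q)^2}{1-q^3+\cfrac{q^{2\nu+1}(1+q^2)^2}{1-q^5+\cfrac{q^{2\nu+2}(1+q^3)^2}{1-q^7+\cdots}}}}}=\frac{\pi}{2k'_rK(k_r)}\exp\left(-4\sum_{j=1}^{\nu-1}\operatorname{arctanh}(q^j)\right),$$ where, in the inner continued fraction beginning with partial numerator $2q^\nu$, the subsequent partial numerators are $q^{2\nu+n-1}(1+q^n)^2$ for $n=1,2,3,\ldots$ and the partial denominators are $1-q^{2n+1}$ for $n=0,1,2,\ldots$.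
   Context: $K(x)=\int_0^{\pi/2}\frac{dt}{\sqrt{1-x^2\sin^2 t}}$ is the complete elliptic integral of the first kind, as a function of the modulus $x$. The value of an infinite continued fraction is the limit of its convergents. An empty sum (the case $\nu=1$) is $0$. *)

theory Defs
  imports "HOL-Analysis.Analysis"
begin

(* The argument is the modulus x, not the parameter x^2. *)
definition ellK :: "real \<Rightarrow> real" where
  "ellK x = integral {0..pi/2} (\<lambda>t. 1 / sqrt (1 - x\<^sup>2 * (sin t)\<^sup>2))"

(* Numerator and denominator of the n-th convergent of
     b 0 + a 1 / (b 1 + a 2 / (b 2 + a 3 / (b 3 + ...)))
   by the Euler-Wallis recurrences; a 0 is never used. *)
fun cf_numer :: "(nat \<Rightarrow> real) \<Rightarrow> (nat \<Rightarrow> real) \<Rightarrow> nat \<Rightarrow> real" where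
  "cf_numer a b 0 = b 0"
| "cf_numer a b (Suc 0) = b 1 * b 0 + a 1"
| "cf_numer a b (Suc (Suc n)) =
     b (n + 2) * cf_numer a b (Suc n) + a (n + 2) * cf_numer a b n"

fun cf_denom :: "(nat \<Rightarrow> real) \<Rightarrow> (nat \<Rightarrow> real) \<Rightarrow> nat \<Rightarrow> real" where
  "cf_denom a b 0 = 1"
| "cf_denom a b (Suc 0) = b 1"
| "cf_denom a b (Suc (Suc n)) =
     b (n + 2) * cf_denom a b (Suc n) + a (n + 2) * cf_denom a b n"

(* As usual, finitely many convergents may be undefined (zero denominator);
   the first conjunct prevents x / 0 = 0 from influencing the limit. *)
definition cf_has_value :: "(nat \<Rightarrow> real) \<Rightarrow> (nat \<Rightarrow> real) \<Rightarrow> real \<Rightarrow> bool" where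
  "cf_has_value a b v \<longleftrightarrow>
     (\<forall>\<^sub>F n in sequentially. cf_denom a b n \<noteq> 0) \<and>
     (\<lambda>n. cf_numer a b n / cf_denom a b n) \<longlonglongrightarrow> v"

(* The elements of
     -1 + 2 / (1 - 2 q^\<nu> / (1 - q + q^(2\<nu>) (1 + q)^2 / (1 - q^3 + ...))),
   read as one continued fraction: the minus sign before 2 q^\<nu> belongs to the
   partial numerator, and a term q^(2\<nu>+n-1) (1 + q^n)^2 with n = m + 1 has
   index m + 3. *)
fun part_num :: "nat \<Rightarrow> real \<Rightarrow> nat \<Rightarrow> real" where
  "part_num \<nu> q 0 = 0"
| "part_num \<nu> q (Suc 0) = 2"
| "part_num \<nu> q (Suc (Suc 0)) = - 2 * q ^ \<nu>"
| "part_num \<nu> q (Suc (Suc (Suc m))) = q ^ (2 * \<nu> + m) * (1 + q ^ (m + 1))\<^sup>2"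

fun part_den :: "real \<Rightarrow> nat \<Rightarrow> real" where
  "part_den q 0 = - 1"
| "part_den q (Suc 0) = 1"
| "part_den q (Suc (Suc n)) = 1 - q ^ (2 * n + 1)"

end

theory Submission
  imports Defs
begin

text \<open>Write \<open>z = q ^ \<nu>\<close> and let \<open>F(x)\<close> (\<open>qbin\<close>) be the \<open>q\<close>-binomial series with
coefficients \<open>(-1;q)\<^sub>n / (q;q)\<^sub>n\<close>, whose sum is the product of the factors
\<open>(1 + x q ^ j) / (1 - x q ^ j)\<close> over all \<open>j \<ge> 0\<close>. So \<open>F(z)\<close> arises from \<open>F(q)\<close> by removing
the factors \<open>(1 + q ^ j) / (1 - q ^ j) = exp (2 artanh (q ^ j))\<close> with \<open>1 \<le> j < \<nu>\<close>, and the
claim splits into two: the continued fraction has the value \<open>F(z)\<^sup>2\<close>, and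
\<open>F(q)\<^sup>2 = \<pi> / (2 k' K(k))\<close>.

For the first claim, \<open>F(x) F(-x) = 1\<close>, so \<open>F(z)\<^sup>2 = F(z) / F(-z)\<close>, and this is a
Moebius function of the ratio of the even part of \<open>F\<close> to its odd part at \<open>z\<close>. Both parts are
Heine series, the first two of a sequence of positive contiguous series (\<open>heine\<close>) whose
three-term recurrence (\<open>heine_three_term\<close>) has exactly the elements of the inner continued
fraction below \<open>2 q ^ \<nu>\<close> as coefficients. All these elements are nonnegative and the
partial numerators tend to zero, so a positive solution of the recurrence forces convergence
to its initial ratio (\<open>cf_positive_has_value\<close>).

For the second claim, an identity of Gauss gives \<open>1 / F(q) = \<theta>\<^sub>4(q)\<close>, so what is
needed is the classical relation of theta functions and elliptic integrals. By rotating the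
lattice of summation, \<open>\<theta>\<^sub>3\<^sup>2\<close> and \<open>\<theta>\<^sub>4\<^sup>2\<close> at \<open>q\<^sup>2\<close> are the arithmetic and the
geometric mean of their values at \<open>q\<close>. Gauss's integral \<open>I(a, b)\<close> is invariant under
these means, and the values tend to 1 along \<open>q, q\<^sup>2, q\<^sup>4, \<dots>\<close>; hence
\<open>I(\<theta>\<^sub>3\<^sup>2, \<theta>\<^sub>4\<^sup>2) = \<pi> / 2\<close>. The complementary integral doubles at every step
and grows logarithmically, which identifies it as \<open>- ln q / 2\<close>. Thus the modulus with
complement \<open>\<theta>\<^sub>4\<^sup>2 / \<theta>\<^sub>3\<^sup>2\<close> has the period ratio \<open>\<surd>r\<close>, and since the
period ratio is strictly monotone in the modulus, it is \<open>k\<close>.\<close>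

section \<open>The elliptic integral in arithmetic-geometric form\<close>

text \<open>The integral whose value is \<open>\<pi> / (2 M(a, b))\<close> for the arithmetic-geometric mean \<open>M\<close>.
Unlike the modulus form of \<open>K\<close>, it is homogeneous and symmetric in two parameters, which is
what the mean iteration needs.\<close>

definition gauss_integral :: "real \<Rightarrow> real \<Rightarrow> real" where
  "gauss_integral a b = integral {0..pi/2} (\<lambda>t. 1 / sqrt (a\<^sup>2 * (cos t)\<^sup>2 + b\<^sup>2 * (sin t)\<^sup>2))"

text \<open>The radicand is a convex combination of \<open>a\<^sup>2\<close> and \<open>b\<^sup>2\<close>.\<close>

lemma gauss_radicand_bounds:
  fixes a b t :: real
  assumes "0 < b" "b \<le> a"
  shows "b\<^sup>2 \<le> a\<^sup>2 * (cos t)\<^sup>2 + b\<^sup>2 * (sin t)\<^sup>2"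
    and "a\<^sup>2 * (cos t)\<^sup>2 + b\<^sup>2 * (sin t)\<^sup>2 \<le> a\<^sup>2"
proof -
  have "b\<^sup>2 \<le> a\<^sup>2" using assms by (intro power_mono) auto
  then have "b\<^sup>2 * (cos t)\<^sup>2 \<le> a\<^sup>2 * (cos t)\<^sup>2" "b\<^sup>2 * (sin t)\<^sup>2 \<le> a\<^sup>2 * (sin t)\<^sup>2"
    by (auto intro: mult_right_mono)
  moreover have "x * (cos t)\<^sup>2 + x * (sin t)\<^sup>2 = x" for x :: real
    by (simp flip: distrib_left)
  ultimately show "b\<^sup>2 \<le> a\<^sup>2 * (cos t)\<^sup>2 + b\<^sup>2 * (sin t)\<^sup>2"
    and "a\<^sup>2 * (cos t)\<^sup>2 + b\<^sup>2 * (sin t)\<^sup>2 \<le> a\<^sup>2"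
    by (smt (verit))+
qed

lemma gauss_radicand_pos:
  fixes a b t :: real
  assumes "0 < a" "0 < b"
  shows "0 < a\<^sup>2 * (cos t)\<^sup>2 + b\<^sup>2 * (sin t)\<^sup>2"
proof (cases "sin t = 0")
  case True
  then have "cos t \<noteq> 0" using sin_cos_squared_add[of t] by auto
  with assms show ?thesis by (intro add_pos_nonneg) auto
next
  case False
  with assms show ?thesis by (intro add_nonneg_pos) auto
qed

lemma continuous_on_gauss_integrand:
  assumes "0 < a" "0 < b"
  shows "continuous_on S (\<lambda>t::real. 1 / sqrt (a\<^sup>2 * (cos t)\<^sup>2 + b\<^sup>2 * (sin t)\<^sup>2))"
  by (intro continuous_intros) (use gauss_radicand_pos[OF assms] in \<open>auto simp: less_le\<close>)

lemma gauss_integral_has_integral: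
  assumes "0 < a" "0 < b"
  shows "((\<lambda>t. 1 / sqrt (a\<^sup>2 * (cos t)\<^sup>2 + b\<^sup>2 * (sin t)\<^sup>2)) has_integral gauss_integral a b) {0..pi/2}"
  unfolding gauss_integral_def
  by (intro integrable_integral integrable_continuous_interval continuous_on_gauss_integrand assms)

lemma ellK_eq_gauss_integral:
  assumes "x\<^sup>2 \<le> 1"
  shows "ellK x = gauss_integral 1 (sqrt (1 - x\<^sup>2))"
proof -
  have "1 - x\<^sup>2 * (sin t)\<^sup>2 = 1\<^sup>2 * (cos t)\<^sup>2 + (sqrt (1 - x\<^sup>2))\<^sup>2 * (sin t)\<^sup>2" for t
    using assms by (simp add: cos_squared_eq algebra_simps)
  then show ?thesis unfolding ellK_def gauss_integral_def by simp
qed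

lemma gauss_integral_scale:
  assumes "0 < c"
  shows "gauss_integral (c * a) (c * b) = gauss_integral a b / c"
proof -
  have "1 / sqrt ((c * a)\<^sup>2 * (cos t)\<^sup>2 + (c * b)\<^sup>2 * (sin t)\<^sup>2) =
        (1 / c) * (1 / sqrt (a\<^sup>2 * (cos t)\<^sup>2 + b\<^sup>2 * (sin t)\<^sup>2))" for t
  proof -
    have "(c * a)\<^sup>2 * (cos t)\<^sup>2 + (c * b)\<^sup>2 * (sin t)\<^sup>2 = c\<^sup>2 * (a\<^sup>2 * (cos t)\<^sup>2 + b\<^sup>2 * (sin t)\<^sup>2)"
      by (simp add: algebra_simps power_mult_distrib)
    then show ?thesis using assms by (simp add: real_sqrt_mult)
  qed
  then show ?thesis unfolding gauss_integral_def by (simp only: integral_mult_right) simp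
qed

lemma integral_reflect_interval:
  fixes f :: "real \<Rightarrow> real"
  shows "integral {a..b} (\<lambda>t. f (a + b - t)) = integral {a..b} f"
proof -
  have "integral {a..b} (\<lambda>t. f (a + b - t)) = integral {-b..-a} (\<lambda>t. f (a + b + t))"
    using Henstock_Kurzweil_Integration.integral_reflect_real[of b a "\<lambda>t. f (a + b - t)"] by simp
  also have "\<dots> = integral {-b + (a + b)..-a + (a + b)} f"
    by (subst integral_shift_Icc_real[symmetric]) (simp add: o_def)
  finally show ?thesis by simp
qed

lemma gauss_integral_commute:
  "gauss_integral a b = gauss_integral b a"
  unfolding gauss_integral_def
  by (subst integral_reflect_interval[symmetric])
     (simp add: sin_diff cos_diff add.commute)

text \<open>Landen's substitution \<open>p = t + arctan ((b / a) tan t)\<close> maps \<open>[0, \<pi>/2]\<close> onto \<open>[0, \<pi>]\<close>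
and turns the integrand for the two means into twice the original one; the integral over
\<open>[0, \<pi>]\<close> is twice the one over \<open>[0, \<pi>/2]\<close> by symmetry. Written with the difference of the
two angles, as \<open>p t = 2 t - arctan (w t)\<close>, the substitution is smooth on the closed interval,
although \<open>tan\<close> has a pole at its right end.\<close>

lemma gauss_integral_landen:
  assumes "0 < a" "0 < b"
  shows "gauss_integral a b = gauss_integral ((a + b) / 2) (sqrt (a * b))"
proof -
  define f where "f = (\<lambda>t. 1 / sqrt (((a + b) / 2)\<^sup>2 * (cos t)\<^sup>2 + (sqrt (a * b))\<^sup>2 * (sin t)\<^sup>2))"
  define N where "N = (\<lambda>t. a * (cos t)\<^sup>2 + b * (sin t)\<^sup>2)"
  define D where "D = (\<lambda>t. a\<^sup>2 * (cos t)\<^sup>2 + b\<^sup>2 * (sin t)\<^sup>2)"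
  define w where "w = (\<lambda>t. (a - b) * (sin t * cos t) / N t)"
  define p where "p = (\<lambda>t. 2 * t - arctan (w t))"
  have Npos: "N t > 0" for t
    using gauss_radicand_pos[of "sqrt a" "sqrt b" t] assms unfolding N_def by simp
  have Dpos: "D t > 0" for t
    using gauss_radicand_pos[of a b t] assms unfolding D_def by simp
  have c2: "(cos t)\<^sup>2 = 1 - (sin t)\<^sup>2" for t :: real by (rule cos_squared_eq)
  have ND: "(N t)\<^sup>2 + (a - b)\<^sup>2 * (sin t * cos t)\<^sup>2 = D t" for t
    unfolding N_def D_def power_mult_distrib c2 by algebra
  have w2: "1 + (w t)\<^sup>2 = D t / (N t)\<^sup>2" for t
  proof -
    have "1 + (w t)\<^sup>2 = ((N t)\<^sup>2 + (a - b)\<^sup>2 * (sin t * cos t)\<^sup>2) / (N t)\<^sup>2"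
      using Npos[of t] by (simp add: w_def power_divide power_mult_distrib add_divide_distrib)
    then show ?thesis unfolding ND .
  qed
  have dN: "(N has_real_derivative (2 * (b - a) * (sin t * cos t))) (at t within S)" for t S
    unfolding N_def by (auto intro!: derivative_eq_intros simp: algebra_simps)
  have dw: "(w has_real_derivative ((a - b) * (a * (cos t)\<^sup>2 - b * (sin t)\<^sup>2) / (N t)\<^sup>2)) (at t within S)" for t S
  proof -
    have "(w has_real_derivative (((a - b) * (cos t * cos t - sin t * sin t)) * N t -
        ((a - b) * (sin t * cos t)) * (2 * (b - a) * (sin t * cos t))) / (N t * N t)) (at t within S)"
      unfolding w_def
      by (rule DERIV_divide[OF _ dN])
        (use Npos[of t] in \<open>auto intro!: derivative_eq_intros simp: algebra_simps\<close>)
    moreover have "((a - b) * (cos t * cos t - sin t * sin t)) * N t -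
        ((a - b) * (sin t * cos t)) * (2 * (b - a) * (sin t * cos t))
        = (a - b) * (a * (cos t)\<^sup>2 - b * (sin t)\<^sup>2)"
    proof -
      have "(cos t * cos t - sin t * sin t) * N t + 2 * (a - b) * ((sin t)\<^sup>2 * (cos t)\<^sup>2)
        = (a * (cos t)\<^sup>2 - b * (sin t)\<^sup>2)"
        unfolding N_def c2 power2_eq_square[symmetric] by algebra
      then show ?thesis by algebra
    qed
    ultimately show ?thesis by (simp add: power2_eq_square)
  qed
  have dp: "(p has_real_derivative ((a + b) * N t / D t)) (at t within S)" for t S
  proof -
    have "(p has_real_derivative (2 - ((a - b) * (a * (cos t)\<^sup>2 - b * (sin t)\<^sup>2) / (N t)\<^sup>2) / (1 + (w t)\<^sup>2))) (at t within S)"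
      unfolding p_def by (auto intro!: derivative_eq_intros dw simp: field_simps)
    also have "(2 - ((a - b) * (a * (cos t)\<^sup>2 - b * (sin t)\<^sup>2) / (N t)\<^sup>2) / (1 + (w t)\<^sup>2))
        = (2 * D t - (a - b) * (a * (cos t)\<^sup>2 - b * (sin t)\<^sup>2)) / D t"
      unfolding w2 using Npos[of t] Dpos[of t] by (simp add: field_simps)
    also have "2 * D t - (a - b) * (a * (cos t)\<^sup>2 - b * (sin t)\<^sup>2) = (a + b) * N t"
      unfolding N_def D_def c2 by algebra
    finally show ?thesis .
  qed
  have sw: "sqrt (1 + (w t)\<^sup>2) = sqrt (D t) / N t" for t
    unfolding w2 using Npos[of t] by (simp add: real_sqrt_divide)
  \<comment> \<open>\<open>sin (p t)\<close> and \<open>cos (p t)\<close> follow from the addition theorems; they show that the new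
      radicand is a perfect square divided by \<open>D t\<close>.\<close>
  have cosaw: "cos (arctan (w t)) = N t / sqrt (D t)" for t
    by (simp add: cos_arctan sw)
  have sinaw: "sin (arctan (w t)) = (a - b) * (sin t * cos t) / sqrt (D t)" for t
    using Npos[of t] by (simp add: sin_arctan sw) (simp add: w_def)
  have sinp: "sin (p t) = (a + b) * (sin t * cos t) / sqrt (D t)" for t
  proof -
    have "sin (p t) = (2 * sin t * cos t * N t - ((cos t)\<^sup>2 - (sin t)\<^sup>2) * ((a - b) * (sin t * cos t))) / sqrt (D t)"
      unfolding p_def sin_diff cosaw sinaw sin_double cos_double by (simp add: diff_divide_distrib)
    also have "2 * sin t * cos t * N t - ((cos t)\<^sup>2 - (sin t)\<^sup>2) * ((a - b) * (sin t * cos t)) =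
       (sin t * cos t) * (2 * N t - ((cos t)\<^sup>2 - (sin t)\<^sup>2) * (a - b))" by algebra
    also have "2 * N t - ((cos t)\<^sup>2 - (sin t)\<^sup>2) * (a - b) = a + b"
      unfolding N_def c2 by algebra
    finally show ?thesis by (simp add: mult.commute)
  qed
  have cosp2: "(cos (p t))\<^sup>2 = (a * (cos t)\<^sup>2 - b * (sin t)\<^sup>2)\<^sup>2 / D t" for t
  proof -
    have "(cos (p t))\<^sup>2 = (D t - (a + b)\<^sup>2 * ((sin t)\<^sup>2 * (cos t)\<^sup>2)) / D t"
      unfolding cos_squared_eq[of "p t"] sinp using Dpos[of t]
      by (simp add: power_divide power_mult_distrib diff_divide_distrib)
    also have "D t - (a + b)\<^sup>2 * ((sin t)\<^sup>2 * (cos t)\<^sup>2) = (a * (cos t)\<^sup>2 - b * (sin t)\<^sup>2)\<^sup>2"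
      unfolding D_def c2 by algebra
    finally show ?thesis .
  qed
  have rad: "((a + b) / 2)\<^sup>2 * (cos (p t))\<^sup>2 + (sqrt (a * b))\<^sup>2 * (sin (p t))\<^sup>2
      = ((a + b) * N t / 2)\<^sup>2 / D t" for t
  proof -
    have "((a + b) / 2)\<^sup>2 * (cos (p t))\<^sup>2 + (sqrt (a * b))\<^sup>2 * (sin (p t))\<^sup>2
      = (((a + b) / 2)\<^sup>2 * (a * (cos t)\<^sup>2 - b * (sin t)\<^sup>2)\<^sup>2 + a * b * ((a + b)\<^sup>2 * ((sin t)\<^sup>2 * (cos t)\<^sup>2))) / D t"
      unfolding cosp2 sinp using assms Dpos[of t]
      by (simp add: power_divide power_mult_distrib add_divide_distrib)
    also have "((a + b) / 2)\<^sup>2 * (a * (cos t)\<^sup>2 - b * (sin t)\<^sup>2)\<^sup>2 + a * b * ((a + b)\<^sup>2 * ((sin t)\<^sup>2 * (cos t)\<^sup>2))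
      = ((a + b) * N t / 2)\<^sup>2"
      unfolding N_def power_mult_distrib power_divide by (simp add: field_simps) algebra
    finally show ?thesis .
  qed
  have fp: "((a + b) * N t / D t) *\<^sub>R f (p t) = 2 * (1 / sqrt (D t))" for t
  proof -
    have "f (p t) = 1 / sqrt (((a + b) * N t / 2)\<^sup>2 / D t)"
      unfolding f_def rad ..
    also have "\<dots> = 2 * sqrt (D t) / ((a + b) * N t)"
      using assms Npos[of t] by (simp add: real_sqrt_divide)
    finally have fpt: "f (p t) = 2 * sqrt (D t) / ((a + b) * N t)" .
    have "D t = sqrt (D t) * sqrt (D t)" using Dpos[of t] by simp
    then have "sqrt (D t) / D t = 1 / sqrt (D t)" using Dpos[of t] by (metis div_self divide_divide_eq_left less_irrefl real_sqrt_gt_zero)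
    then show ?thesis unfolding fpt using assms Npos[of t] by simp
  qed
  have contf: "continuous_on S f" for S
    unfolding f_def by (rule continuous_on_gauss_integrand) (use assms in auto)
  have p0: "p 0 = 0" and p1: "p (pi/2) = pi" by (simp_all add: p_def w_def)
  have pran: "p ` {0..pi/2} \<subseteq> {0..pi}"
  proof -
    have "mono_on {0..pi/2} p"
    proof (rule mono_onI)
      fix r s :: real assume "r \<le> s"
      then show "p r \<le> p s"
      proof (rule DERIV_nonneg_imp_nondecreasing)
        fix x show "\<exists>y. (p has_real_derivative y) (at x) \<and> 0 \<le> y"
          using dp[of x UNIV] assms Npos[of x] Dpos[of x] by (meson add_pos_pos divide_nonneg_pos less_imp_le mult_pos_pos)
      qed
    qed
    then have "p 0 \<le> p t" "p t \<le> p (pi/2)" if "t \<in> {0..pi/2}" for t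
      using that by (auto intro!: mono_onD[where f = p])
    then show ?thesis unfolding p0 p1 by auto
  qed
  have "((\<lambda>t. ((a + b) * N t / D t) *\<^sub>R f (p t)) has_integral (integral {p 0..p (pi/2)} f)) {0..pi/2}"
    by (rule has_integral_substitution[where c=0 and d=pi])
       (use pran p0 p1 in \<open>auto intro!: contf dp\<close>)
  then have "((\<lambda>t. 2 * (1 / sqrt (D t))) has_integral (integral {0..pi} f)) {0..pi/2}"
    by (simp only: fp p0 p1)
  moreover have "((\<lambda>t. 2 * (1 / sqrt (D t))) has_integral (2 * gauss_integral a b)) {0..pi/2}"
    using gauss_integral_has_integral[OF assms] unfolding D_def by (rule has_integral_mult_right)
  ultimately have 1: "2 * gauss_integral a b = integral {0..pi} f" by (rule has_integral_unique[symmetric])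
  have "integral {0..pi} f = integral {0..pi/2} f + integral {pi/2..pi} f"
    by (rule Henstock_Kurzweil_Integration.integral_combine[symmetric])
      (auto intro!: integrable_continuous_interval contf)
  also have "integral {pi/2..pi} f = integral {0..pi/2} f"
  proof -
    have "f (pi - t) = f t" for t by (simp add: f_def)
    then have "integral {0..pi/2} f = integral {0..pi/2} (\<lambda>t. f (pi - t))" by simp
    also have "\<dots> = integral {-(pi/2)..-0} (\<lambda>t. f (pi + t))"
      using Henstock_Kurzweil_Integration.integral_reflect_real[of "pi/2" 0 "\<lambda>t. f (pi - t)"] by simp
    also have "\<dots> = integral {-(pi/2) + pi..-0 + pi} f"
      by (subst integral_shift_Icc_real[symmetric]) (simp add: o_def)
    finally show ?thesis by simp
  qed
  finally have "integral {0..pi} f = 2 * gauss_integral ((a + b) / 2) (sqrt (a * b))"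
    by (simp add: gauss_integral_def f_def)
  with 1 show ?thesis by simp
qed

lemma gauss_integral_bounds:
  assumes "0 < b" "b \<le> a"
  shows "pi / (2 * a) \<le> gauss_integral a b" and "gauss_integral a b \<le> pi / (2 * b)"
proof -
  let ?f = "\<lambda>t. 1 / sqrt (a\<^sup>2 * (cos t)\<^sup>2 + b\<^sup>2 * (sin t)\<^sup>2)"
  have I: "(?f has_integral gauss_integral a b) {0..pi/2}"
    using assms by (intro gauss_integral_has_integral) auto
  have C: "((\<lambda>_. c) has_integral c * (pi/2)) {0..pi/2}" for c :: real
    using has_integral_const_real[of c 0 "pi/2"] by (simp add: mult.commute)
  have le: "b \<le> sqrt (a\<^sup>2 * (cos t)\<^sup>2 + b\<^sup>2 * (sin t)\<^sup>2)"
       "sqrt (a\<^sup>2 * (cos t)\<^sup>2 + b\<^sup>2 * (sin t)\<^sup>2) \<le> a" for t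
    using gauss_radicand_bounds[OF assms, of t] assms
    by (auto intro!: real_le_rsqrt real_le_lsqrt)
  have "(1 / a) * (pi / 2) \<le> gauss_integral a b"
    using C I by (rule has_integral_le) (use le assms in \<open>auto intro!: divide_left_mono mult_pos_pos simp: gauss_radicand_pos\<close>)
  then show "pi / (2 * a) \<le> gauss_integral a b" by simp
  have "gauss_integral a b \<le> (1 / b) * (pi / 2)"
    using I C by (rule has_integral_le) (use le assms in \<open>auto intro!: divide_left_mono mult_pos_pos simp: gauss_radicand_pos\<close>)
  then show "gauss_integral a b \<le> pi / (2 * b)" by simp
qed

lemma gauss_integral_strict_antimono:
  assumes "0 < a" "0 < b" "b < c"
  shows "gauss_integral a c < gauss_integral a b"
  unfolding gauss_integral_def
proof (rule integral_less_real)
  fix t :: real assume t: "t \<in> {0<..<pi/2}"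
  then have "0 < sin t" by (intro sin_gt_zero) auto
  then have "b\<^sup>2 * (sin t)\<^sup>2 < c\<^sup>2 * (sin t)\<^sup>2"
    using assms by (intro mult_strict_right_mono power_strict_mono) auto
  then show "1 / sqrt (a\<^sup>2 * (cos t)\<^sup>2 + c\<^sup>2 * (sin t)\<^sup>2) < 1 / sqrt (a\<^sup>2 * (cos t)\<^sup>2 + b\<^sup>2 * (sin t)\<^sup>2)"
    using gauss_radicand_pos[of a b t] gauss_radicand_pos[of a c t] assms
    by (intro divide_strict_left_mono mult_pos_pos) auto
qed (use assms pi_gt_zero in \<open>auto intro!: continuous_on_gauss_integrand simp del: pi_gt_zero\<close>)

text \<open>As \<open>c\<close> tends to 0 the integral grows like \<open>ln (1 / c)\<close>. After exchanging \<open>a\<close> and \<open>c\<close> the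
radicand is \<open>c\<^sup>2 + b\<^sup>2 sin\<^sup>2 t\<close>. Multiplying the integrand by \<open>cos t\<close> makes it elementary,
with antiderivative \<open>arsinh (b sin t / c) / b\<close>, and the part removed,
\<open>(1 - cos t) / sqrt (R t)\<close>, stays between 0 and \<open>1 / b\<close>.\<close>

lemma gauss_integral_log_bounds:
  assumes "0 < b" "b < a"
  defines "c \<equiv> sqrt (a\<^sup>2 - b\<^sup>2)"
  shows "arsinh (b / c) / b \<le> gauss_integral a c"
    and "gauss_integral a c \<le> arsinh (b / c) / b + pi / (2 * b)"
proof -
  have "b\<^sup>2 < a\<^sup>2" using assms by (intro power_strict_mono) auto
  then have c: "0 < c" "c\<^sup>2 = a\<^sup>2 - b\<^sup>2" by (simp_all add: c_def less_imp_le)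
  define R where "R = (\<lambda>t. c\<^sup>2 + b\<^sup>2 * (sin t)\<^sup>2)"
  have Rpos: "R t > 0" for t unfolding R_def using c(1) by (intro add_pos_nonneg) auto
  have R: "c\<^sup>2 * (cos t)\<^sup>2 + a\<^sup>2 * (sin t)\<^sup>2 = R t" for t
    unfolding R_def c(2) cos_squared_eq by algebra
  have I: "((\<lambda>t. 1 / sqrt (R t)) has_integral gauss_integral a c) {0..pi/2}"
    using gauss_integral_has_integral[of c a] c(1) assms(1,2)
    unfolding R gauss_integral_commute[of a c] by simp
  have J: "((\<lambda>t. cos t / sqrt (R t)) has_integral (arsinh (b / c) / b)) {0..pi/2}"
  proof -
    have "((\<lambda>t. cos t / sqrt (R t)) has_integral (arsinh (b * sin (pi/2) / c) / b - arsinh (b * sin 0 / c) / b)) {0..pi/2}"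
    proof (rule fundamental_theorem_of_calculus)
      fix t :: real assume "t \<in> {0..pi/2}"
      have "(b * sin t / c)\<^sup>2 + 1 = R t / c\<^sup>2"
        using c(1) by (simp add: R_def field_simps)
      then have s: "sqrt ((b * sin t / c)\<^sup>2 + 1) = sqrt (R t) / c"
        using c(1) by (simp add: real_sqrt_divide)
      have "((\<lambda>t. arsinh (b * sin t / c) / b) has_real_derivative
           (1 / sqrt ((b * sin t / c)\<^sup>2 + 1)) * (b * cos t / c) / b) (at t within {0..pi/2})"
        by (intro DERIV_cdivide DERIV_chain2[of arsinh] arsinh_real_has_field_derivative)
          (auto intro!: derivative_eq_intros)
      also have "(1 / sqrt ((b * sin t / c)\<^sup>2 + 1)) * (b * cos t / c) / b = cos t / sqrt (R t)"
        unfolding s using c(1) assms by simp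
      finally show "((\<lambda>t. arsinh (b * sin t / c) / b) has_vector_derivative cos t / sqrt (R t)) (at t within {0..pi/2})"
        by (simp add: has_real_derivative_iff_has_vector_derivative)
    qed simp
    then show ?thesis by simp
  qed
  have cosb: "0 \<le> cos t" if "t \<in> {0..pi/2}" for t using that by (intro cos_ge_zero) auto
  show "arsinh (b / c) / b \<le> gauss_integral a c"
    using J I
  proof (rule has_integral_le)
    fix t :: real assume t: "t \<in> {0..pi/2}"
    show "cos t / sqrt (R t) \<le> 1 / sqrt (R t)"
      using Rpos[of t] by (intro divide_right_mono) auto
  qed
  have C: "((\<lambda>_. 1 / b) has_integral pi / (2 * b)) {0..pi/2}"
    using has_integral_const_real[of "1 / b" 0 "pi/2"] by simp
  show "gauss_integral a c \<le> arsinh (b / c) / b + pi / (2 * b)"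
    using I has_integral_add[OF J C]
  proof (rule has_integral_le)
    fix t :: real assume t: "t \<in> {0..pi/2}"
    have "b * (1 - cos t) \<le> sqrt (R t)"
    proof (rule real_le_rsqrt)
      have "1 - cos t \<le> 1" "0 \<le> 1 - cos t" using cosb[OF t] by auto
      have "(1 - cos t)\<^sup>2 \<le> (sin t)\<^sup>2"
      proof -
        have "(1 - cos t) * (1 - cos t) \<le> (1 - cos t) * (1 + cos t)"
          using cosb[OF t] by (intro mult_left_mono) auto
        also have "\<dots> = (sin t)\<^sup>2" unfolding sin_squared_eq by algebra
        finally show ?thesis by (simp add: power2_eq_square)
      qed
      then have "b\<^sup>2 * (1 - cos t)\<^sup>2 \<le> b\<^sup>2 * (sin t)\<^sup>2" by (intro mult_left_mono) auto
      then show "(b * (1 - cos t))\<^sup>2 \<le> R t"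
        unfolding R_def power_mult_distrib using c by (smt (verit) zero_le_power2)
    qed
    then have "(1 - cos t) / sqrt (R t) \<le> 1 / b"
      using Rpos[of t] assms by (simp add: field_simps)
    then show "1 / sqrt (R t) \<le> cos t / sqrt (R t) + 1 / b"
      by (simp add: diff_divide_distrib)
  qed
qed

text \<open>If \<open>c\<^sup>2 = a\<^sup>2 - b\<^sup>2\<close>, then \<open>(a - b) / 2\<close> plays the role of \<open>c\<close> for the two means of \<open>a\<close>
and \<open>b\<close>. Conversely \<open>a\<close> and \<open>c\<close> are themselves the two means of \<open>a + b\<close> and \<open>a - b\<close>, so
the complementary integral is an integral of the same chain read backwards; the factor 2
comes from homogeneity.\<close>

lemma gauss_integral_complementary:
  assumes "0 < b" "b < a"
  shows "gauss_integral ((a + b) / 2) ((a - b) / 2) = 2 * gauss_integral a (sqrt (a\<^sup>2 - b\<^sup>2))"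
proof -
  have "gauss_integral (a + b) (a - b) = gauss_integral ((a + b + (a - b)) / 2) (sqrt ((a + b) * (a - b)))"
    using assms by (intro gauss_integral_landen) auto
  also have "(a + b) * (a - b) = a\<^sup>2 - b\<^sup>2" by algebra
  finally have "gauss_integral (a + b) (a - b) = gauss_integral a (sqrt (a\<^sup>2 - b\<^sup>2))" by simp
  moreover have "gauss_integral ((1/2) * (a + b)) ((1/2) * (a - b)) = gauss_integral (a + b) (a - b) / (1/2)"
    by (rule gauss_integral_scale) simp
  ultimately show ?thesis by simp
qed

text \<open>\<open>K\<close> is strictly increasing, so the ratio \<open>K(k') / K(k)\<close> is strictly decreasing in \<open>k\<close>.\<close>

lemma ellK_ratio_determines_modulus:
  assumes "0 < k" "k < 1" "0 < l" "l < 1"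
    and "ellK (sqrt (1 - k\<^sup>2)) / ellK k = ellK (sqrt (1 - l\<^sup>2)) / ellK l"
  shows "k = l"
proof -
  have K: "ellK x = gauss_integral 1 (sqrt (1 - x\<^sup>2))" "ellK (sqrt (1 - x\<^sup>2)) = gauss_integral 1 x"
    if "0 < x" "x < 1" for x
  proof -
    have "x\<^sup>2 \<le> 1" using that by (auto simp: abs_square_le_1)
    then show "ellK x = gauss_integral 1 (sqrt (1 - x\<^sup>2))" "ellK (sqrt (1 - x\<^sup>2)) = gauss_integral 1 x"
      using ellK_eq_gauss_integral[of x] ellK_eq_gauss_integral[of "sqrt (1 - x\<^sup>2)"] that by simp_all
  qed
  have pos: "0 < gauss_integral 1 x" if "0 < x" "x < 1" for x
    using gauss_integral_bounds(1)[of x 1] that pi_gt_zero by linarith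
  have anti: "ellK (sqrt (1 - y\<^sup>2)) / ellK y < ellK (sqrt (1 - x\<^sup>2)) / ellK x"
    if "0 < x" "x < y" "y < 1" for x y
  proof -
    have sq: "x\<^sup>2 < y\<^sup>2" "y\<^sup>2 < 1" "0 < x\<^sup>2" using that by (auto intro: power_strict_mono simp: abs_square_less_1)
    then have "gauss_integral 1 (sqrt (1 - x\<^sup>2)) < gauss_integral 1 (sqrt (1 - y\<^sup>2))"
      by (intro gauss_integral_strict_antimono) auto
    moreover have "gauss_integral 1 y < gauss_integral 1 x"
      using that by (intro gauss_integral_strict_antimono) auto
    moreover have "0 < gauss_integral 1 (sqrt (1 - x\<^sup>2))" "0 < gauss_integral 1 y"
      using that sq by (auto intro!: pos)
    ultimately show ?thesis using that by (simp add: K frac_less)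
  qed
  show ?thesis
    using anti[of k l] anti[of l k] assms by (cases k l rule: linorder_cases) auto
qed

section \<open>Continued fractions with nonnegative elements\<close>

lemma summable_if_ratio_tendsto:
  fixes f r :: "nat \<Rightarrow> real"
  assumes "\<And>n. f (Suc n) = r n * f n" "r \<longlonglongrightarrow> \<rho>" "\<bar>\<rho>\<bar> < 1"
  shows "summable f"
proof -
  obtain c where c: "\<bar>\<rho>\<bar> < c" "c < 1" using assms(3) dense by blast
  have "(\<lambda>n. \<bar>r n\<bar>) \<longlonglongrightarrow> \<bar>\<rho>\<bar>" using assms(2) by (rule tendsto_rabs)
  then have "eventually (\<lambda>n. \<bar>r n\<bar> < c) sequentially" using c(1) by (rule order_tendstoD)
  then obtain N where N: "\<bar>r n\<bar> < c" if "n \<ge> N" for n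
    by (auto simp: eventually_at_top_linorder)
  show ?thesis
  proof (rule summable_ratio_test[of c N])
    fix n assume "n \<ge> N"
    then show "norm (f (Suc n)) \<le> c * norm (f n)"
      unfolding assms(1) norm_mult using N[of n] by (intro mult_right_mono) auto
  qed (fact c(2))
qed

text \<open>The left-hand side satisfies the recurrence of the convergents; substituting the recurrence of
\<open>G\<close>, it collapses to a single product. This is the error term of the convergents against
\<open>G 0 / G 1\<close>.\<close>

lemma cf_positive_determinant:
  fixes a b G :: "nat \<Rightarrow> real"
  assumes rec: "\<And>n. G n = b n * G (Suc n) + a (Suc n) * G (n + 2)"
  shows "G 0 * cf_denom a b n - G 1 * cf_numer a b n = (-1) ^ n * (\<Prod>i = 1..Suc n. a i) * G (n + 2)"
proof (induction n rule: induct_nat_012)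
  case 0
  show ?case using rec[of 0] by (simp add: numeral_2_eq_2)
next
  case 1
  have "G 0 * b 1 - G 1 * (b 1 * b 0 + a 1) = b 1 * (G 0 - b 0 * G 1) - a 1 * G 1"
    by algebra
  also have "\<dots> = - (a 1 * (G 1 - b 1 * G 2))" using rec[of 0] by (simp add: numeral_2_eq_2 algebra_simps)
  also have "G 1 - b 1 * G 2 = a 2 * G 3" using rec[of 1] by (simp add: numeral_2_eq_2 numeral_3_eq_3)
  finally show ?case by (simp add: numeral_2_eq_2 numeral_3_eq_3)
next
  case (ge2 n)
  define P where "P = (\<Prod>i = 1..Suc n. a i)"
  have P1: "(\<Prod>i = 1..Suc (Suc n). a i) = P * a (n + 2)"
   and P2: "(\<Prod>i = 1..Suc (Suc (Suc n)). a i) = P * a (n + 2) * a (n + 3)"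
    by (simp_all add: P_def eval_nat_numeral)
  have "G 0 * cf_denom a b (Suc (Suc n)) - G 1 * cf_numer a b (Suc (Suc n)) =
     b (n + 2) * (G 0 * cf_denom a b (Suc n) - G 1 * cf_numer a b (Suc n)) +
     a (n + 2) * (G 0 * cf_denom a b n - G 1 * cf_numer a b n)"
    by (simp add: algebra_simps)
  also have "\<dots> = (-1) ^ n * (P * a (n + 2)) * (G (n + 2) - b (n + 2) * G (n + 3))"
    unfolding ge2 P1 P_def[symmetric] by (simp add: algebra_simps eval_nat_numeral)
  also have "G (n + 2) - b (n + 2) * G (n + 3) = a (n + 3) * G (n + 4)"
    using rec[of "n + 2"] by (simp add: eval_nat_numeral)
  finally show ?case unfolding P2 by (simp add: algebra_simps eval_nat_numeral)
qed

lemma cf_denom_ge_power: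
  fixes a b :: "nat \<Rightarrow> real"
  assumes "\<And>n. a n \<ge> 0" "\<And>n. b n \<ge> \<beta>" "\<beta> > 0"
  shows "cf_denom a b n \<ge> \<beta> ^ n"
proof (induction n rule: induct_nat_012)
  case 1 show ?case using assms by simp
next
  case (ge2 n)
  have "\<beta> ^ Suc (Suc n) \<le> b (n + 2) * cf_denom a b (Suc n)"
    unfolding power_Suc[of \<beta> "Suc n"]
    using ge2 assms(2)[of "n + 2"] assms(3) by (intro mult_mono) auto
  moreover have "0 \<le> cf_denom a b n" using ge2(1) assms(3) by (meson less_imp_le order_trans zero_le_power)
  then have "0 \<le> a (n + 2) * cf_denom a b n" using assms(1) by simp
  ultimately show ?case by simp
qed simp

text \<open>A positive solution of the recurrence is automatically the minimal one: \<open>G\<close> grows at most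
like \<open>\<beta>\<close> to the power \<open>-n\<close>, the denominators are at least \<open>\<beta> ^ n\<close>, and the product of the
partial numerators decays faster than any geometric sequence because they tend to zero.\<close>

lemma cf_positive_has_value:
  fixes a b G :: "nat \<Rightarrow> real"
  assumes a: "\<And>n. a n \<ge> 0" "a \<longlonglongrightarrow> 0" and b: "\<And>n. b n \<ge> \<beta>" "\<beta> > 0"
    and G: "\<And>n. G n > 0"
    and rec: "\<And>n. G n = b n * G (Suc n) + a (Suc n) * G (n + 2)"
  shows "(\<lambda>n. cf_numer a b n / cf_denom a b n) \<longlonglongrightarrow> G 0 / G 1"
proof -
  have Gle: "G (Suc n) \<le> G n / \<beta>" for n
  proof -
    have "\<beta> * G (Suc n) \<le> b n * G (Suc n)" using b(1)[of n] G[of "Suc n"] by (intro mult_right_mono) auto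
    also have "\<dots> \<le> G n" using rec[of n] a(1)[of "Suc n"] G[of "n + 2"] by simp
    finally show ?thesis using b(2) by (simp add: field_simps)
  qed
  have Gn: "G n \<le> G 0 / \<beta> ^ n" for n
  proof (induction n)
    case (Suc n)
    have "G (Suc n) \<le> G n / \<beta>" by (rule Gle)
    also have "\<dots> \<le> (G 0 / \<beta> ^ n) / \<beta>" using Suc b(2) by (intro divide_right_mono) auto
    finally show ?case by (simp add: mult.commute)
  qed simp
  define p where "p = (\<lambda>n. (\<Prod>i = 1..Suc n. a i) / (\<beta>\<^sup>2) ^ n)"
  have "p \<longlonglongrightarrow> 0"
  proof (rule summable_LIMSEQ_zero, rule summable_if_ratio_tendsto)
    show "p (Suc n) = (a (n + 2) / \<beta>\<^sup>2) * p n" for n by (simp add: p_def mult_ac)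
    show "(\<lambda>n. a (n + 2) / \<beta>\<^sup>2) \<longlonglongrightarrow> 0"
      using LIMSEQ_ignore_initial_segment[OF a(2), of 2] by (auto intro: tendsto_divide_zero)
  qed simp
  then have lim: "(\<lambda>n. G 0 / (\<beta>\<^sup>2 * G 1) * p n) \<longlonglongrightarrow> 0" by (rule tendsto_mult_right_zero)
  have bound: "norm (G 0 / G 1 - cf_numer a b n / cf_denom a b n) \<le> G 0 / (\<beta>\<^sup>2 * G 1) * p n" for n
  proof -
    let ?P = "\<Prod>i = 1..Suc n. a i"
    have P: "?P \<ge> 0" by (intro prod_nonneg) (use a in auto)
    have D: "cf_denom a b n \<ge> \<beta> ^ n" using a(1) b by (rule cf_denom_ge_power)
    have bn: "\<beta> ^ n > 0" using b by simp
    then have "cf_denom a b n > 0" using D by linarith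
    have "G 0 / G 1 - cf_numer a b n / cf_denom a b n =
          (G 0 * cf_denom a b n - G 1 * cf_numer a b n) / (G 1 * cf_denom a b n)"
      using \<open>cf_denom a b n > 0\<close> G[of 1] by (simp add: field_simps)
    also have "\<dots> = (-1) ^ n * ?P * G (n + 2) / (G 1 * cf_denom a b n)"
      by (subst cf_positive_determinant[OF rec]) rule
    also have "norm \<dots> = ?P * G (n + 2) / (G 1 * cf_denom a b n)"
      using P G[of 1] G[of "n + 2"] \<open>cf_denom a b n > 0\<close> by (simp add: abs_mult del: prod.cl_ivl_Suc)
    also have "\<dots> \<le> ?P * (G 0 / \<beta> ^ (n + 2)) / (G 1 * \<beta> ^ n)"
      using P G[of 1] G[of "n + 2"] Gn[of "n + 2"] D bn
      by (intro frac_le mult_left_mono mult_pos_pos mult_nonneg_nonneg) (auto simp: less_imp_le simp del: prod.cl_ivl_Suc)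
    also have "\<dots> = G 0 / (\<beta>\<^sup>2 * G 1) * p n"
      by (simp add: p_def power_add power2_eq_square power_mult_distrib mult_ac del: prod.cl_ivl_Suc)
    finally show ?thesis .
  qed
  have "(\<lambda>n. G 0 / G 1 - cf_numer a b n / cf_denom a b n) \<longlonglongrightarrow> 0"
    using lim by (rule Lim_null_comparison[rotated]) (use bound in auto)
  then have "(\<lambda>n. G 0 / G 1 - (G 0 / G 1 - cf_numer a b n / cf_denom a b n)) \<longlonglongrightarrow> G 0 / G 1 - 0"
    by (intro tendsto_diff tendsto_const)
  then show ?thesis by simp
qed

text \<open>Removes the prefix \<open>-1 + 2 / (1 + \<dots>)\<close>. Its Moebius transformation sends \<open>x\<close>, the value of
the remaining continued fraction, to \<open>(x - a 2) / (x + a 2)\<close>, and it acts on numerator and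
denominator of each convergent separately.\<close>

lemma cf_cons_cons:
  fixes a b :: "nat \<Rightarrow> real"
  assumes "b 0 = -1" "a 1 = 2" "b 1 = 1"
  defines "a' \<equiv> \<lambda>n. a (n + 2)" and "b' \<equiv> \<lambda>n. b (n + 2)"
  shows "cf_numer a b (n + 2) = cf_numer a' b' n - a 2 * cf_denom a' b' n \<and>
         cf_denom a b (n + 2) = cf_numer a' b' n + a 2 * cf_denom a' b' n"
proof (induction n rule: induct_nat_012)
  case 0
  show ?case using assms(1-3) by (simp add: a'_def b'_def numeral_2_eq_2)
next
  case 1
  show ?case using assms(1-3)
    by (simp add: a'_def b'_def numeral_2_eq_2) (simp add: algebra_simps)
next
  case (ge2 n)
  have shift: "cf_numer a b (Suc (Suc n) + 2) = b' (n + 2) * cf_numer a b (Suc n + 2) + a' (n + 2) * cf_numer a b (n + 2)"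
    "cf_denom a b (Suc (Suc n) + 2) = b' (n + 2) * cf_denom a b (Suc n + 2) + a' (n + 2) * cf_denom a b (n + 2)"
    by (simp_all add: a'_def b'_def)
  show ?case
    unfolding shift ge2[THEN conjunct1] ge2[THEN conjunct2] cf_numer.simps cf_denom.simps
    by (intro conjI; algebra)
qed

section \<open>The q-binomial series and Heine series\<close>

text \<open>The quotient \<open>(-1;q)\<^sub>n / (q;q)\<^sub>n\<close> of \<open>q\<close>-shifted factorials.\<close>

definition qbin_coeff :: "real \<Rightarrow> nat \<Rightarrow> real" where
  "qbin_coeff q n = (\<Prod>i<n. (1 + q ^ i) / (1 - q ^ Suc i))"

definition qbin :: "real \<Rightarrow> real \<Rightarrow> real" where
  "qbin q x = (\<Sum>n. qbin_coeff q n * x ^ n)"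

text \<open>In basic hypergeometric notation with base \<open>q\<^sup>2\<close>, \<open>heine q z n\<close> is the Heine series
\<open>\<^sub>2\<phi>\<^sub>1(-q\<^sup>n, -q\<^sup>n\<^sup>+\<^sup>1; q\<^sup>2\<^sup>n\<^sup>+\<^sup>1; q\<^sup>2, z\<^sup>2)\<close> divided by \<open>(q;q\<^sup>2)\<^sub>n\<close>. The normalization is chosen so that
the contiguous relation has the coefficients of the continued fraction without further
rescaling.\<close>

definition heine_coeff :: "real \<Rightarrow> nat \<Rightarrow> nat \<Rightarrow> real" where
  "heine_coeff q n m = (\<Prod>i<2*m. 1 + q ^ (n + i)) /
     ((\<Prod>i<m. 1 - q ^ (2 * i + 2)) * (\<Prod>i<m + n. 1 - q ^ (2 * i + 1)))"

definition heine :: "real \<Rightarrow> real \<Rightarrow> nat \<Rightarrow> real" where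
  "heine q z n = (\<Sum>m. heine_coeff q n m * z ^ (2 * m))"

context
  fixes q :: real
  assumes q: "0 < q" "q < 1"
begin

lemma q_powers: "0 < q ^ n" "q ^ n \<le> 1" "q ^ Suc n < 1" "n > 0 \<Longrightarrow> q ^ n < 1"
  using q power_Suc_less_one[of q n] by (auto simp: power_le_one power_less_one_iff simp del: power_Suc)

lemma q_power_tendsto: "(\<lambda>n. q ^ (a * n + b)) \<longlonglongrightarrow> 0" if "a > 0"
proof -
  have "(\<lambda>n. (q ^ a) ^ n * q ^ b) \<longlonglongrightarrow> 0"
    using q q_powers(1,4)[of a] that by (intro tendsto_mult_left_zero LIMSEQ_power_zero) auto
  then show ?thesis by (simp add: power_add power_mult)
qed

lemma qbin_coeff_0 [simp]: "qbin_coeff q 0 = 1"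
  by (simp add: qbin_coeff_def)

lemma qbin_coeff_Suc: "qbin_coeff q (Suc n) * (1 - q ^ Suc n) = qbin_coeff q n * (1 + q ^ n)"
  using q_powers(3)[of n] by (simp add: qbin_coeff_def)

lemma qbin_coeff_nonneg: "qbin_coeff q n \<ge> 0"
  unfolding qbin_coeff_def using q_powers by (intro prod_nonneg) (auto simp: less_imp_le add_nonneg_nonneg)

lemma qbin_summable:
  assumes "\<bar>x\<bar> < 1"
  shows "summable (\<lambda>n. qbin_coeff q n * x ^ n)"
proof (rule summable_if_ratio_tendsto)
  show "qbin_coeff q (Suc n) * x ^ Suc n = (1 + q ^ n) / (1 - q ^ Suc n) * x * (qbin_coeff q n * x ^ n)" for n
    by (simp add: qbin_coeff_def)
  have "(\<lambda>n. (1 + q ^ (1 * n + 0)) / (1 - q ^ (1 * n + 1)) * x) \<longlonglongrightarrow> (1 + 0) / (1 - 0) * x"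
    by (intro tendsto_intros q_power_tendsto) auto
  then show "(\<lambda>n. (1 + q ^ n) / (1 - q ^ Suc n) * x) \<longlonglongrightarrow> x" by simp
qed (fact assms)

lemma qbin_sums: "\<bar>x\<bar> < 1 \<Longrightarrow> (\<lambda>n. qbin_coeff q n * x ^ n) sums qbin q x"
  unfolding qbin_def using qbin_summable by (rule summable_sums)

lemma abs_q_power_mult_less: "\<bar>x\<bar> < 1 \<Longrightarrow> \<bar>q ^ n * x\<bar> < 1"
  using q_powers[of n] by (simp add: abs_mult) (smt (verit) mult_left_le_one_le)

text \<open>Comparing coefficients in \<open>F(x) - F(q x) = x (F(x) + F(q x))\<close>, which is the ratio of
consecutive coefficients. The product formula for \<open>F\<close> is this equation iterated.\<close>

lemma qbin_functional_equation:
  assumes "\<bar>x\<bar> < 1"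
  shows "qbin q x * (1 - x) = (1 + x) * qbin q (q * x)"
proof -
  let ?C = "qbin_coeff q"
  have qx: "\<bar>q * x\<bar> < 1" using abs_q_power_mult_less[OF assms, of 1] by simp
  have 1: "(\<lambda>n. ?C n * x ^ n - ?C n * (q * x) ^ n) sums (qbin q x - qbin q (q * x))"
    by (intro sums_diff qbin_sums assms qx)
  have 2: "(\<lambda>n. x * (?C n * x ^ n + ?C n * (q * x) ^ n)) sums (x * (qbin q x + qbin q (q * x)))"
    by (intro sums_mult sums_add qbin_sums assms qx)
  have "?C (Suc n) * x ^ Suc n - ?C (Suc n) * (q * x) ^ Suc n = x * (?C n * x ^ n + ?C n * (q * x) ^ n)" for n
  proof -
    have "?C (Suc n) * x ^ Suc n - ?C (Suc n) * (q * x) ^ Suc n = (?C (Suc n) * (1 - q ^ Suc n)) * x ^ Suc n"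
      unfolding power_mult_distrib by algebra
    also note qbin_coeff_Suc
    also have "?C n * (1 + q ^ n) * x ^ Suc n = x * (?C n * x ^ n + ?C n * (q * x) ^ n)"
      unfolding power_mult_distrib power_Suc by algebra
    finally show ?thesis .
  qed
  with 2 have "(\<lambda>n. ?C (Suc n) * x ^ Suc n - ?C (Suc n) * (q * x) ^ Suc n) sums (x * (qbin q x + qbin q (q * x)))"
    by simp
  from sums_Suc[OF this]
  have "(\<lambda>n. ?C n * x ^ n - ?C n * (q * x) ^ n) sums (x * (qbin q x + qbin q (q * x)))"
    by simp
  with 1 have "qbin q x - qbin q (q * x) = x * (qbin q x + qbin q (q * x))"
    by (rule sums_unique2)
  then show ?thesis by algebra
qed

lemma qbin_0 [simp]: "qbin q 0 = 1"
  unfolding qbin_def by simp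

lemma qbin_tendsto_1:
  assumes "X \<longlonglongrightarrow> 0"
  shows "(\<lambda>n. qbin q (X n)) \<longlonglongrightarrow> 1"
proof -
  have "isCont (\<lambda>x. \<Sum>n. qbin_coeff q n * x ^ n) 0"
    using qbin_summable[of "1/2"] by (intro isCont_powser[where K = "1/2"]) auto
  then have "isCont (qbin q) 0" by (simp add: qbin_def[abs_def])
  from isCont_tendsto_compose[OF this assms] show ?thesis by simp
qed

text \<open>By the functional equation the product is invariant under \<open>x \<mapsto> q x\<close>, so by continuity it
equals its value at 0.\<close>

lemma qbin_mult_minus:
  assumes "\<bar>x\<bar> < 1"
  shows "qbin q x * qbin q (- x) = 1"
proof -
  have step: "qbin q (q * y) * qbin q (- (q * y)) = qbin q y * qbin q (- y)" if "\<bar>y\<bar> < 1" for y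
  proof -
    have "((1 + y) * qbin q (q * y)) * ((1 - y) * qbin q (q * - y)) = (qbin q y * (1 - y)) * (qbin q (- y) * (1 + y))"
      using qbin_functional_equation[of y] qbin_functional_equation[of "- y"] that by simp
    moreover have "1 + y \<noteq> 0" "1 - y \<noteq> 0" using that by auto
    ultimately show ?thesis by simp
  qed
  have const: "qbin q (q ^ n * x) * qbin q (- (q ^ n * x)) = qbin q x * qbin q (- x)" for n
  proof (induction n)
    case (Suc n)
    then show ?case using step[OF abs_q_power_mult_less[OF assms, of n]] by (simp add: mult.assoc)
  qed simp
  have "(\<lambda>n. q ^ n * x) \<longlonglongrightarrow> 0"
    using q_power_tendsto[of 1 0] by (auto intro: tendsto_mult_left_zero)
  moreover from this have "(\<lambda>n. - (q ^ n * x)) \<longlonglongrightarrow> 0" by (simp add: tendsto_minus_cancel_left[symmetric])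
  ultimately have "(\<lambda>n. qbin q (q ^ n * x) * qbin q (- (q ^ n * x))) \<longlonglongrightarrow> 1 * 1"
    by (intro tendsto_mult qbin_tendsto_1)
  then show ?thesis unfolding const by (simp add: LIMSEQ_const_iff)
qed

lemma qbin_ge_1:
  assumes "0 \<le> x" "x < 1"
  shows "qbin q x \<ge> 1"
proof -
  have "(\<Sum>n<1. qbin_coeff q n * x ^ n) \<le> qbin q x"
    unfolding qbin_def using assms qbin_coeff_nonneg
    by (intro sum_le_suminf qbin_summable) auto
  then show ?thesis by simp
qed

lemma qbin_power:
  "qbin q (q ^ Suc n) = (\<Prod>j = 1..n. (1 - q ^ j) / (1 + q ^ j)) * qbin q q"
proof (induction n)
  case (Suc n)
  have "qbin q (q ^ Suc n) * (1 - q ^ Suc n) = (1 + q ^ Suc n) * qbin q (q ^ Suc (Suc n))"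
    using qbin_functional_equation[of "q ^ Suc n"] q_powers[of "Suc n"] by simp
  then have "qbin q (q ^ Suc (Suc n)) = (1 - q ^ Suc n) / (1 + q ^ Suc n) * qbin q (q ^ Suc n)"
    using q_powers(1)[of "Suc n"] by (simp add: field_simps)
  then show ?case unfolding Suc by (simp add: mult_ac)
qed simp

text \<open>The factor \<open>(1 - q ^ j) / (1 + q ^ j)\<close> of \<open>qbin_power\<close> is \<open>exp (- 2 artanh (q ^ j))\<close>.\<close>

lemma qbin_power_eq_exp:
  assumes "\<nu> \<ge> 1"
  shows "(qbin q (q ^ \<nu>))\<^sup>2 = (qbin q q)\<^sup>2 * exp (- 4 * (\<Sum>j = 1..<\<nu>. artanh (q ^ j)))"
proof -
  have factor: "exp (- 2 * artanh (q ^ j)) = (1 - q ^ j) / (1 + q ^ j)" if "j \<ge> 1" for j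
  proof -
    have "0 < q ^ j" "q ^ j < 1" using q that by (auto simp: power_less_one_iff)
    then have "0 < (1 + q ^ j) / (1 - q ^ j)" by simp
    then show ?thesis
      by (simp add: artanh_def exp_minus)
  qed
  obtain n where n: "\<nu> = Suc n" using assms by (cases \<nu>) auto
  have "exp (- 4 * (\<Sum>j = 1..<\<nu>. artanh (q ^ j))) = (exp (\<Sum>j = 1..n. - 2 * artanh (q ^ j)))\<^sup>2"
    unfolding n atLeastLessThanSuc_atLeastAtMost sum_distrib_left[symmetric]
    by (simp flip: exp_double)
  also have "exp (\<Sum>j = 1..n. - 2 * artanh (q ^ j)) = (\<Prod>j = 1..n. (1 - q ^ j) / (1 + q ^ j))"
    unfolding exp_sum[OF finite_atLeastAtMost] by (intro prod.cong factor) auto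
  finally show ?thesis unfolding n qbin_power by (simp add: power_mult_distrib)
qed

section \<open>A sequence of contiguous Heine series\<close>

lemma heine_coeff_pos: "heine_coeff q n m > 0"
  unfolding heine_coeff_def using q_powers
  by (intro divide_pos_pos mult_pos_pos prod_pos) (auto simp: add_pos_pos simp del: power_Suc)

lemma heine_coeff_Suc:
  "heine_coeff q n (Suc m) = (1 + q ^ (2 * m + n)) * (1 + q ^ (2 * m + n + 1)) /
     ((1 - q ^ (2 * m + 2)) * (1 - q ^ (2 * m + (2 * n + 1)))) * heine_coeff q n m"
proof -
  have num: "(\<Prod>i<2 * Suc m. 1 + q ^ (n + i)) =
      (\<Prod>i<2 * m. 1 + q ^ (n + i)) * (1 + q ^ (2 * m + n)) * (1 + q ^ (2 * m + n + 1))"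
  proof -
    have eq: "2 * Suc m = Suc (Suc (2 * m))" by simp
    show ?thesis unfolding eq prod.lessThan_Suc by (simp only: add_ac Suc_eq_plus1)
  qed
  have den: "(\<Prod>i<Suc m + n. 1 - q ^ (2 * i + 1)) =
      (\<Prod>i<m + n. 1 - q ^ (2 * i + 1)) * (1 - q ^ (2 * m + (2 * n + 1)))"
    by (simp add: add_ac distrib_left)
  show ?thesis
    unfolding heine_coeff_def num den prod.lessThan_Suc[of _ m] times_divide_times_eq
    by (simp only: mult_ac)
qed

lemma heine_coeff_rec_0: "heine_coeff q n 0 = (1 - q ^ (2 * n + 1)) * heine_coeff q (Suc n) 0"
  unfolding heine_coeff_def using q_powers(3)[of "2 * n"] by simp

text \<open>Over the common denominator this is the polynomial identity
\<open>(1 + y) (1 - q w y\<^sup>2) = (1 - q y\<^sup>2) (1 + y w) + y (1 + q y) (1 - w)\<close>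
for \<open>y = q ^ n\<close> and \<open>w = q ^ (2 m + 2)\<close>.\<close>

lemma heine_coeff_rec_Suc:
  "heine_coeff q n (Suc m) = (1 - q ^ (2 * n + 1)) * heine_coeff q (Suc n) (Suc m)
     + q ^ n * (1 + q ^ Suc n)\<^sup>2 * heine_coeff q (n + 2) m"
proof -
  define N where "N = (\<Prod>i<2*m. 1 + q ^ (n + 2 + i))"
  define E where "E = (\<Prod>i<m. 1 - q ^ (2 * i + 2))"
  define D where "D = (\<Prod>i<m + n + 1. 1 - q ^ (2 * i + 1))"
  define y where "y = q ^ n"
  define w where "w = q ^ (2 * m + 2)"
  have N0: "(\<Prod>i<2 * Suc m. 1 + q ^ (n + i)) = (1 + y) * (1 + q * y) * N"
  proof -
    have eq: "2 * Suc m = Suc (Suc (2 * m))" by simp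
    show ?thesis unfolding eq prod.lessThan_Suc_shift by (simp add: N_def y_def)
  qed
  have N1: "(\<Prod>i<2 * Suc m. 1 + q ^ (Suc n + i)) = (1 + q * y) * N * (1 + y * w)"
  proof -
    have "(\<Prod>i<2 * Suc m. 1 + q ^ (Suc n + i)) = (\<Prod>i<Suc (2 * m). 1 + q ^ (Suc n + i)) * (1 + y * w)"
      by (simp add: y_def w_def power_add mult_ac)
    also have "(\<Prod>i<Suc (2 * m). 1 + q ^ (Suc n + i)) = (1 + q * y) * N"
      by (subst prod.lessThan_Suc_shift) (simp add: N_def y_def)
    finally show ?thesis .
  qed
  have E1: "(\<Prod>i<Suc m. 1 - q ^ (2 * i + 2)) = E * (1 - w)"
    by (simp add: E_def w_def)
  have D1: "(\<Prod>i<Suc m + Suc n. 1 - q ^ (2 * i + 1)) = D * (1 - q * w * y\<^sup>2)"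
       and D2: "(\<Prod>i<m + (n + 2). 1 - q ^ (2 * i + 1)) = D * (1 - q * w * y\<^sup>2)"
       and D0: "(\<Prod>i<Suc m + n. 1 - q ^ (2 * i + 1)) = D"
    by (simp_all add: D_def w_def y_def power_add power_mult mult_ac power2_eq_square power_mult_distrib)
  have pos: "E \<noteq> 0" "D \<noteq> 0" "1 - w \<noteq> 0"
    using less_imp_neq[OF q_powers(3)] by (auto simp: E_def D_def w_def prod_zero_iff simp del: power_Suc)
  define d where "d = 1 - q * w * y\<^sup>2"
  have "d \<noteq> 0"
  proof -
    have "q * w * y\<^sup>2 = q ^ Suc (2 * m + 2 + 2 * n)"
      by (simp add: w_def y_def power_add power_mult mult_ac power2_eq_square power_mult_distrib)
    then show ?thesis using q_powers(3)[of "2 * m + 2 + 2 * n"] by (simp del: power_Suc add: d_def)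
  qed
  have q2: "q ^ (2 * n + 1) = q * y\<^sup>2" "q ^ n = y" "q ^ Suc n = q * y"
    by (simp_all add: y_def power_mult power2_eq_square power_mult_distrib)
  have "(1 - q * y\<^sup>2) * ((1 + q * y) * N * (1 + y * w) / (E * (1 - w) * (D * d))) +
        y * (1 + q * y)\<^sup>2 * (N / (E * (D * d))) =
        (1 + q * y) * N * ((1 - q * y\<^sup>2) * (1 + y * w) + y * (1 + q * y) * (1 - w)) / (E * (1 - w) * (D * d))"
    using pos \<open>d \<noteq> 0\<close> by (simp add: divide_simps) algebra
  also have "(1 - q * y\<^sup>2) * (1 + y * w) + y * (1 + q * y) * (1 - w) = (1 + y) * d"
    unfolding d_def by algebra
  also have "(1 + q * y) * N * ((1 + y) * d) / (E * (1 - w) * (D * d)) =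
     (1 + y) * (1 + q * y) * N / (E * (1 - w) * D)"
    using \<open>d \<noteq> 0\<close> by (simp add: mult_ac)
  finally show ?thesis
    unfolding heine_coeff_def N0 N1 E1 D0 D1 D2 N_def[symmetric] E_def[symmetric] q2 d_def[symmetric] ..
qed

lemma heine_summable:
  assumes "\<bar>z\<bar> < 1"
  shows "summable (\<lambda>m. heine_coeff q n m * z ^ (2 * m))"
proof (rule summable_if_ratio_tendsto)
  let ?r = "\<lambda>m. (1 + q ^ (2 * m + n)) * (1 + q ^ (2 * m + n + 1)) /
     ((1 - q ^ (2 * m + 2)) * (1 - q ^ (2 * m + (2 * n + 1)))) * z\<^sup>2"
  show "heine_coeff q n (Suc m) * z ^ (2 * Suc m) = ?r m * (heine_coeff q n m * z ^ (2 * m))" for m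
    unfolding heine_coeff_Suc by (simp add: power2_eq_square)
  have "?r \<longlonglongrightarrow> (1 + 0) * (1 + 0) / ((1 - 0) * (1 - 0)) * z\<^sup>2"
    unfolding add.assoc[of _ n 1]
    by (intro tendsto_intros q_power_tendsto) auto
  then show "?r \<longlonglongrightarrow> z\<^sup>2" by simp
  show "\<bar>z\<^sup>2\<bar> < 1" using assms by (simp add: abs_square_less_1)
qed

lemma heine_pos:
  assumes "\<bar>z\<bar> < 1"
  shows "heine q z n > 0"
proof -
  have "(\<Sum>m<1. heine_coeff q n m * z ^ (2 * m)) \<le> heine q z n"
    unfolding heine_def using heine_coeff_pos
    by (intro sum_le_suminf heine_summable assms) (auto simp: less_imp_le power_mult)
  then show ?thesis using heine_coeff_pos[of n 0] by simp
qed

lemma heine_three_term: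
  assumes "\<bar>z\<bar> < 1"
  shows "heine q z n = (1 - q ^ (2 * n + 1)) * heine q z (Suc n)
           + z\<^sup>2 * q ^ n * (1 + q ^ Suc n)\<^sup>2 * heine q z (n + 2)"
proof -
  let ?c = "z\<^sup>2 * q ^ n * (1 + q ^ Suc n)\<^sup>2"
  let ?t = "\<lambda>n m. heine_coeff q n m * z ^ (2 * m)"
  have S: "?t n sums heine q z n" for n
    unfolding heine_def using heine_summable[OF assms] by (rule summable_sums)
  have "(\<lambda>m. ?t n m - (1 - q ^ (2 * n + 1)) * ?t (Suc n) m) sums
      (heine q z n - (1 - q ^ (2 * n + 1)) * heine q z (Suc n))"
    by (intro sums_diff sums_mult S)
  moreover have "(\<lambda>m. ?t n m - (1 - q ^ (2 * n + 1)) * ?t (Suc n) m) sums (?c * heine q z (n + 2))"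
  proof -
    have "?t n (Suc m) - (1 - q ^ (2 * n + 1)) * ?t (Suc n) (Suc m) = ?c * ?t (n + 2) m" for m
    proof -
      have zz: "z ^ (2 * Suc m) = z\<^sup>2 * z ^ (2 * m)" by (simp add: power2_eq_square)
      show ?thesis unfolding heine_coeff_rec_Suc[of n m] zz by algebra
    qed
    then have "(\<lambda>m. ?t n (Suc m) - (1 - q ^ (2 * n + 1)) * ?t (Suc n) (Suc m)) sums (?c * heine q z (n + 2))"
      using sums_mult[OF S[of "n + 2"], of ?c] by simp
    from sums_Suc[OF this] show ?thesis using heine_coeff_rec_0[of n] by simp
  qed
  ultimately have "heine q z n - (1 - q ^ (2 * n + 1)) * heine q z (Suc n) = ?c * heine q z (n + 2)"
    by (rule sums_unique2)
  then show ?thesis by simp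
qed

lemma qbin_coeff_even: "qbin_coeff q (2 * m) = heine_coeff q 0 m"
  and qbin_coeff_odd: "qbin_coeff q (2 * m + 1) = 2 * heine_coeff q 1 m"
proof -
  have step: "qbin_coeff q (Suc n) = qbin_coeff q n * (1 + q ^ n) / (1 - q ^ Suc n)" for n
    using qbin_coeff_Suc[of n] q_powers(3)[of n] by (simp add: field_simps)
  show even: "qbin_coeff q (2 * m) = heine_coeff q 0 m"
  proof (induction m)
    case (Suc m)
    have "qbin_coeff q (2 * Suc m) = qbin_coeff q (Suc (Suc (2 * m)))" by simp
    then show ?case unfolding step Suc heine_coeff_Suc by (simp add: mult_ac)
  qed (simp add: heine_coeff_def)
  show "qbin_coeff q (2 * m + 1) = 2 * heine_coeff q 1 m"
  proof (induction m)
    case (Suc m)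
    have "qbin_coeff q (2 * Suc m + 1) = qbin_coeff q (Suc (Suc (2 * m + 1)))" by simp
    then show ?case unfolding step Suc heine_coeff_Suc by (simp add: mult_ac numeral_3_eq_3)
  qed (simp add: heine_coeff_def step)
qed

text \<open>As \<open>heine\<close> is even in \<open>z\<close>, this splits \<open>F\<close> into its even and its odd part.\<close>

lemma qbin_eq_heine:
  assumes "\<bar>z\<bar> < 1"
  shows "qbin q z = heine q z 0 + 2 * z * heine q z 1"
proof -
  let ?t = "\<lambda>n m. heine_coeff q n m * z ^ (2 * m)"
  have S: "?t n sums heine q z n" for n
    unfolding heine_def using heine_summable[OF assms] by (rule summable_sums)
  have "(\<lambda>n. if even n then ?t 0 (n div 2) else 2 * z * ?t 1 ((n - 1) div 2)) sums
      (2 * z * heine q z 1 + heine q z 0)"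
    by (intro sums_if sums_mult S)
  moreover have "(if even n then ?t 0 (n div 2) else 2 * z * ?t 1 ((n - 1) div 2)) =
       qbin_coeff q n * z ^ n" for n
  proof (cases "even n")
    case True
    then obtain m where "n = 2 * m" by blast
    then show ?thesis by (simp add: qbin_coeff_even)
  next
    case False
    then obtain m where "n = 2 * m + 1" by (rule oddE)
    then show ?thesis using qbin_coeff_odd[of m] by simp
  qed
  ultimately have "(\<lambda>n. qbin_coeff q n * z ^ n) sums (2 * z * heine q z 1 + heine q z 0)" by simp
  with qbin_sums[OF assms] have "qbin q z = 2 * z * heine q z 1 + heine q z 0" by (rule sums_unique2)
  then show ?thesis by simp
qed

text \<open>The inner continued fraction is the ratio of the first two Heine series, and the prefix turns
this ratio into \<open>F(z) / F(-z) = F(z)\<^sup>2\<close>. The denominators are eventually nonzero because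
\<open>F(-z) > 0\<close> keeps the inner value above the pole \<open>2 z\<close> of the prefix.\<close>

lemma continued_fraction_value:
  assumes "\<nu> \<ge> 1"
  shows "cf_has_value (part_num \<nu> q) (part_den q) ((qbin q (q ^ \<nu>))\<^sup>2)"
proof -
  define z where "z = q ^ \<nu>"
  define a where "a = (\<lambda>n. part_num \<nu> q (n + 2))"
  define b where "b = (\<lambda>n. part_den q (n + 2))"
  \<comment> \<open>The element of \<open>a\<close> with index 0 is \<open>-2 q ^ \<nu>\<close>. Replacing it by 0 makes all partial
      numerators nonnegative and leaves the convergents unchanged.\<close>
  define a' where "a' = a(0 := 0)"
  define G where "G = heine q z"
  have z: "0 < z" "z < 1" "\<bar>z\<bar> < 1" using q_powers(1,4)[of \<nu>] assms by (auto simp: z_def)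
  have a_Suc: "a (Suc n) = z\<^sup>2 * q ^ n * (1 + q ^ Suc n)\<^sup>2" for n
    by (simp add: a_def z_def power_add power_mult[symmetric] mult.commute)
  have b: "b n = 1 - q ^ (2 * n + 1)" for n by (simp add: b_def)
  have cf_cong: "cf_numer a' b n = cf_numer a b n \<and> cf_denom a' b n = cf_denom a b n" for n
    by (induction n rule: induct_nat_012) (simp_all add: a'_def)
  have b_ge: "b n \<ge> 1 - q" for n
    using q power_decreasing[of 1 "2 * n + 1" q] unfolding b by simp
  have a'_nonneg: "a' n \<ge> 0" for n
    using q z by (cases n) (auto simp: a'_def a_Suc)
  have "(\<lambda>n. cf_numer a' b n / cf_denom a' b n) \<longlonglongrightarrow> G 0 / G 1"
  proof (rule cf_positive_has_value)
    show "a' n \<ge> 0" for n by (rule a'_nonneg)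
    have "(\<lambda>n. z\<^sup>2 * q ^ (1 * n + 0) * (1 + q ^ (1 * n + 1))\<^sup>2) \<longlonglongrightarrow> z\<^sup>2 * 0 * (1 + 0)\<^sup>2"
      by (intro tendsto_intros q_power_tendsto) auto
    then have "(\<lambda>n. a' (Suc n)) \<longlonglongrightarrow> 0" by (simp add: a'_def a_Suc)
    then show "a' \<longlonglongrightarrow> 0" by (rule LIMSEQ_imp_Suc)
    show "b n \<ge> 1 - q" for n by (rule b_ge)
    show "1 - q > 0" using q by simp
    show "G n > 0" for n unfolding G_def using z(3) by (rule heine_pos)
    show "G n = b n * G (Suc n) + a' (Suc n) * G (n + 2)" for n
      using heine_three_term[OF z(3), of n] by (simp add: G_def b a'_def a_Suc)
  qed
  then have lim: "(\<lambda>n. cf_numer a b n / cf_denom a b n) \<longlonglongrightarrow> G 0 / G 1" using cf_cong by simp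
  have Bpos: "cf_denom a b n > 0" for n
  proof -
    have "cf_denom a' b n \<ge> (1 - q) ^ n"
      using a'_nonneg b_ge q by (intro cf_denom_ge_power) auto
    then show ?thesis using cf_cong[of n] q by (smt (verit) zero_less_power)
  qed
  have Fz: "qbin q z = G 0 + 2 * z * G 1" and Fmz: "qbin q (- z) = G 0 - 2 * z * G 1"
    using qbin_eq_heine[of z] qbin_eq_heine[of "- z"] z by (simp_all add: G_def heine_def)
  have F1: "qbin q z * qbin q (- z) = 1" using z(3) by (rule qbin_mult_minus)
  have "qbin q z \<ge> 1" using z by (intro qbin_ge_1) auto
  then have "qbin q (- z) > 0" using F1 by (smt (verit) zero_less_mult_iff)
  have G1: "G 1 > 0" unfolding G_def using z(3) by (rule heine_pos)
  have gap: "G 0 / G 1 > 2 * z"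
    using \<open>qbin q (- z) > 0\<close> G1 unfolding Fmz by (simp add: field_simps)
  have full: "cf_numer (part_num \<nu> q) (part_den q) (n + 2) = cf_denom a b n * (cf_numer a b n / cf_denom a b n + 2 * z)"
      "cf_denom (part_num \<nu> q) (part_den q) (n + 2) = cf_denom a b n * (cf_numer a b n / cf_denom a b n - 2 * z)" for n
  proof -
    have two: "part_num \<nu> q 2 = - (2 * z)" by (simp add: numeral_2_eq_2 z_def)
    have "part_den q 0 = - 1" "part_num \<nu> q 1 = 2" "part_den q 1 = 1" by simp_all
    note cons = cf_cons_cons[of "part_den q" "part_num \<nu> q" n, OF this, folded a_def b_def, unfolded two]
    show "cf_numer (part_num \<nu> q) (part_den q) (n + 2) = cf_denom a b n * (cf_numer a b n / cf_denom a b n + 2 * z)"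
      unfolding cons[THEN conjunct1] using Bpos[of n] by (simp add: distrib_left)
    show "cf_denom (part_num \<nu> q) (part_den q) (n + 2) = cf_denom a b n * (cf_numer a b n / cf_denom a b n - 2 * z)"
      unfolding cons[THEN conjunct2] using Bpos[of n] by (simp add: right_diff_distrib)
  qed
  have "eventually (\<lambda>n. cf_numer a b n / cf_denom a b n > 2 * z) sequentially"
    using lim gap by (rule order_tendstoD)
  then have "eventually (\<lambda>n. cf_denom (part_num \<nu> q) (part_den q) (n + 2) \<noteq> 0) sequentially"
    by eventually_elim (use Bpos full(2) in \<open>auto simp: less_le\<close>)
  then have 1: "eventually (\<lambda>n. cf_denom (part_num \<nu> q) (part_den q) n \<noteq> 0) sequentially"
    by (subst (asm) eventually_sequentially_seg)
  have "(\<lambda>n. cf_numer (part_num \<nu> q) (part_den q) (n + 2) / cf_denom (part_num \<nu> q) (part_den q) (n + 2))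
     \<longlonglongrightarrow> (G 0 / G 1 + 2 * z) / (G 0 / G 1 - 2 * z)"
  proof -
    have "cf_numer (part_num \<nu> q) (part_den q) (n + 2) / cf_denom (part_num \<nu> q) (part_den q) (n + 2) =
      (cf_numer a b n / cf_denom a b n + 2 * z) / (cf_numer a b n / cf_denom a b n - 2 * z)" for n
      unfolding full using Bpos[of n] by (subst mult_divide_mult_cancel_left) auto
    moreover have "(\<lambda>n. (cf_numer a b n / cf_denom a b n + 2 * z) / (cf_numer a b n / cf_denom a b n - 2 * z))
      \<longlonglongrightarrow> (G 0 / G 1 + 2 * z) / (G 0 / G 1 - 2 * z)"
      using gap by (intro tendsto_intros lim) auto
    ultimately show ?thesis by simp
  qed
  also have "(G 0 / G 1 + 2 * z) / (G 0 / G 1 - 2 * z) = qbin q z / qbin q (- z)"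
    using G1 \<open>qbin q (- z) > 0\<close> gap unfolding Fz Fmz by (simp add: divide_simps)
  also have "\<dots> = (qbin q z)\<^sup>2"
    using F1 \<open>qbin q (- z) > 0\<close> by (simp add: field_simps power2_eq_square)
  finally have 2: "(\<lambda>n. cf_numer (part_num \<nu> q) (part_den q) n / cf_denom (part_num \<nu> q) (part_den q) n) \<longlonglongrightarrow> (qbin q z)\<^sup>2"
    by (rule LIMSEQ_offset)
  from 1 2 show ?thesis unfolding cf_has_value_def z_def by simp
qed

section \<open>Gauss's product for the alternating theta series\<close>

text \<open>This makes the boundary term of the telescoping sum below a single term of the theta series.\<close>

lemma gauss_product_qbin_coeff:
  "(\<Prod>j = 1..n. (1 - q ^ j) / (1 + q ^ j)) * (qbin_coeff q (Suc n) * (1 - q ^ Suc n)) = 2"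
proof (induction n)
  case 0
  show ?case unfolding qbin_coeff_Suc by simp
next
  case (Suc n)
  have "1 + q ^ Suc n \<noteq> 0" using q_powers(1)[of "Suc n"] by simp
  then have "(1 - q ^ Suc n) / (1 + q ^ Suc n) * (qbin_coeff q (Suc n) * (1 + q ^ Suc n))
     = qbin_coeff q (Suc n) * (1 - q ^ Suc n)"
    by (simp del: power_Suc)
  moreover have "(\<Prod>j = 1..Suc n. (1 - q ^ j) / (1 + q ^ j)) =
     (\<Prod>j = 1..n. (1 - q ^ j) / (1 + q ^ j)) * ((1 - q ^ Suc n) / (1 + q ^ Suc n))"
    by simp
  ultimately show ?case
    unfolding qbin_coeff_Suc[of "Suc n"] using Suc by (simp only: mult.assoc)
qed

text \<open>A finite form of Gauss's theta identity, in the manner of Shanks. When \<open>n\<close> grows by one, the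
right-hand side changes by a sum over \<open>s\<close> that telescopes, leaving just
\<open>2 (-1) ^ (n + 1) q ^ ((n + 1)\<^sup>2)\<close>. The sum over \<open>s\<close> is a partial sum of \<open>F\<close> at \<open>- q ^ (n + 1)\<close>.\<close>

lemma gauss_finite_identity:
  "1 + 2 * (\<Sum>s = 1..n. (-1) ^ s * q ^ s\<^sup>2) =
   (\<Prod>j = 1..n. (1 - q ^ j) / (1 + q ^ j)) * (\<Sum>s\<le>n. (-1) ^ s * qbin_coeff q s * q ^ (Suc n * s))"
proof (induction n)
  case (Suc n)
  let ?c = "\<lambda>s. (-1) ^ s * qbin_coeff q s"
  define P where "P = (\<Prod>j = 1..n. (1 - q ^ j) / (1 + q ^ j))"
  define y where "y = q ^ Suc n"
  have y: "y > 0" unfolding y_def by (rule q_powers)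
  define t where "t = (\<lambda>s. ?c s * (1 - q ^ s) * y ^ s)"
  define A where "A = (\<Sum>s\<le>n. ?c s * (q * y) ^ s)"
  define B where "B = (\<Sum>s\<le>n. ?c s * y ^ s)"
  have "(1 - y) * A - (1 + y) * B = (\<Sum>s<Suc n. t (Suc s) - t s)"
    unfolding A_def B_def sum_distrib_left sum_subtractf[symmetric] lessThan_Suc_atMost
  proof (rule sum.cong)
    fix s
    have t_Suc: "t (Suc s) = - (?c s * (1 + q ^ s)) * y ^ Suc s"
      unfolding t_def using qbin_coeff_Suc[of s] by simp
    show "(1 - y) * (?c s * (q * y) ^ s) - (1 + y) * (?c s * y ^ s) = t (Suc s) - t s"
      unfolding t_Suc unfolding t_def power_mult_distrib power_Suc by algebra
  qed simp
  also have "\<dots> = t (Suc n)"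
    by (subst sum_lessThan_telescope) (simp add: t_def)
  also have "\<dots> = ?c (Suc n) * (1 - y) * y ^ Suc n" by (simp add: t_def y_def)
  finally have tel: "(1 - y) * A = (1 + y) * B + ?c (Suc n) * (1 - y) * y ^ Suc n" by simp
  have yq: "q ^ (Suc (Suc n) * s) = (q * y) ^ s" "q ^ (Suc n * s) = y ^ s" for s
    by (simp_all add: y_def power_mult[symmetric] power_mult_distrib power_add)
  have P: "P * (qbin_coeff q (Suc n) * (1 - y)) = 2"
    unfolding P_def y_def by (rule gauss_product_qbin_coeff)
  have "(\<Prod>j = 1..Suc n. (1 - q ^ j) / (1 + q ^ j)) * (\<Sum>s\<le>Suc n. ?c s * q ^ (Suc (Suc n) * s))
      = (P * ((1 - y) / (1 + y))) * (A + ?c (Suc n) * (q * y) ^ Suc n)"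
    unfolding yq A_def P_def y_def by simp
  also have "(q * y) ^ Suc n = y * y ^ Suc n" by (simp add: y_def power_mult_distrib)
  also have "(P * ((1 - y) / (1 + y))) * (A + ?c (Suc n) * (y * y ^ Suc n)) =
     P * (((1 - y) * (A + ?c (Suc n) * (y * y ^ Suc n))) / (1 + y))"
    by simp
  also have "(1 - y) * (A + ?c (Suc n) * (y * y ^ Suc n)) =
     (1 + y) * (B + ?c (Suc n) * (1 - y) * y ^ Suc n)"
  proof -
    have "(1 - y) * (A + c * (y * Y)) = (1 + y) * (B + c * (1 - y) * Y)"
      if "(1 - y) * A = (1 + y) * B + c * (1 - y) * Y" for c Y
      using that by algebra
    then show ?thesis using tel .
  qed
  also have "P * ((1 + y) * (B + ?c (Suc n) * (1 - y) * y ^ Suc n) / (1 + y)) =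
      P * B + (P * (qbin_coeff q (Suc n) * (1 - y))) * ((-1) ^ Suc n * y ^ Suc n)"
  proof -
    have "1 + y \<noteq> 0" using y by simp
    show ?thesis
      unfolding nonzero_mult_div_cancel_left[OF \<open>1 + y \<noteq> 0\<close>] by (simp only: distrib_left mult_ac)
  qed
  also have "y ^ Suc n = q ^ (Suc n)\<^sup>2" by (simp only: y_def power_mult[symmetric] power2_eq_square)
  also have "P * B = 1 + 2 * (\<Sum>s = 1..n. (-1) ^ s * q ^ s\<^sup>2)"
    unfolding Suc P_def B_def yq ..
  finally show ?case unfolding P by simp
qed simp

text \<open>In the finite identity the product tends to \<open>1 / F(q)\<close>, and the sum tends to its term for
\<open>s = 0\<close>: the other terms are bounded by \<open>F(q ^ (n + 1)) - 1\<close>.\<close>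

lemma gauss_theta_limit:
  "(\<lambda>n. 1 + 2 * (\<Sum>s = 1..n. (-1) ^ s * q ^ s\<^sup>2)) \<longlonglongrightarrow> 1 / qbin q q"
proof -
  let ?S = "\<lambda>n. \<Sum>s\<le>n. (-1) ^ s * qbin_coeff q s * q ^ (Suc n * s)"
  have qq: "qbin q q > 0" using qbin_ge_1[of q] q by simp
  have lim: "(\<lambda>n. qbin q (q ^ Suc n)) \<longlonglongrightarrow> 1"
    using q_power_tendsto[of 1 1] by (intro qbin_tendsto_1) simp
  have "(\<lambda>n. qbin q (q ^ Suc n) / qbin q q) \<longlonglongrightarrow> 1 / qbin q q"
    using qq by (intro tendsto_intros lim) auto
  then have P: "(\<lambda>n. \<Prod>j = 1..n. (1 - q ^ j) / (1 + q ^ j)) \<longlonglongrightarrow> 1 / qbin q q"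
    unfolding qbin_power using qq by simp
  have "(\<lambda>n. ?S n - 1) \<longlonglongrightarrow> 0"
  proof (rule Lim_null_comparison)
    show "(\<lambda>n. qbin q (q ^ Suc n) - 1) \<longlonglongrightarrow> 0" using tendsto_diff[OF lim tendsto_const[of 1]] by simp
    show "\<forall>\<^sub>F n in sequentially. norm (?S n - 1) \<le> qbin q (q ^ Suc n) - 1"
    proof (intro always_eventually allI)
      fix n
      have abs: "\<bar>q ^ Suc n\<bar> < 1" using q_powers(1,3)[of "Suc n"] q_powers(3)[of n] by simp
      have "?S n - 1 = (\<Sum>s = 1..n. (-1) ^ s * qbin_coeff q s * q ^ (Suc n * s))"
        by (simp add: atMost_atLeast0 sum.atLeast_Suc_atMost)
      also have "norm \<dots> \<le> (\<Sum>s = 1..n. qbin_coeff q s * (q ^ Suc n) ^ s)"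
        using qbin_coeff_nonneg q
        by (intro sum_norm_le) (simp add: abs_mult power_mult[symmetric] del: power_Suc)
      also have "\<dots> = (\<Sum>s\<le>n. qbin_coeff q s * (q ^ Suc n) ^ s) - 1"
        by (simp add: atMost_atLeast0 sum.atLeast_Suc_atMost)
      also have "(\<Sum>s\<le>n. qbin_coeff q s * (q ^ Suc n) ^ s) \<le> qbin q (q ^ Suc n)"
        unfolding qbin_def using qbin_coeff_nonneg q
        by (intro sum_le_suminf qbin_summable abs) auto
      finally show "norm (?S n - 1) \<le> qbin q (q ^ Suc n) - 1" by simp
    qed
  qed
  then have "?S \<longlonglongrightarrow> 1" by (rule LIM_zero_cancel)
  from tendsto_mult[OF P this] show ?thesis unfolding gauss_finite_identity by simp
qed

end

section \<open>Theta functions\<close>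

lemma even_has_sum_int:
  fixes h :: "int \<Rightarrow> real"
  assumes even: "\<And>m. h (- m) = h m" and sums: "(\<lambda>n. h (int (Suc n))) sums s"
    and summable: "summable (\<lambda>n. \<bar>h (int (Suc n))\<bar>)"
  shows "(h has_sum (h 0 + 2 * s)) UNIV"
proof -
  let ?P = "range (\<lambda>n. int (Suc n))" and ?N = "range (\<lambda>n. - int (Suc n))"
  have nat: "((\<lambda>n. h (int (Suc n))) has_sum s) UNIV"
    using norm_summable_imp_has_sum[of "\<lambda>n. h (int (Suc n))"] summable sums by simp
  have inj: "inj (\<lambda>n. int (Suc n))" "inj (\<lambda>n. - int (Suc n))"
    by (auto simp: inj_def)
  have P: "(h has_sum s) ?P"
    unfolding has_sum_reindex[OF inj(1)] o_def by (rule nat)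
  have N: "(h has_sum s) ?N"
    unfolding has_sum_reindex[OF inj(2)] o_def even by (rule nat)
  have Z: "(h has_sum h 0) {0}" using has_sum_finite[of "{0}" h] by simp
  have "(h has_sum (h 0 + s + s)) ({0} \<union> ?P \<union> ?N)"
    by (intro has_sum_Un_disjoint Z P N) auto
  also have "{0} \<union> ?P \<union> ?N = UNIV"
  proof -
    have "m \<in> {0} \<union> ?P \<union> ?N" for m :: int
    proof (cases m rule: int_cases3)
      case (pos n)
      then have "m = int (Suc (n - 1))" by simp
      then show ?thesis by blast
    next
      case (neg n)
      then have "m = - int (Suc (n - 1))" by simp
      then show ?thesis by blast
    qed simp
    then show ?thesis by blast
  qed
  also have "h 0 + s + s = h 0 + 2 * s" by simp
  finally show ?thesis .
qed

lemma has_sum_product: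
  fixes f :: "'a \<Rightarrow> real" and g :: "'b \<Rightarrow> real"
  assumes f: "(f has_sum a) A" "(\<lambda>x. \<bar>f x\<bar>) summable_on A"
    and g: "(g has_sum b) B" "(\<lambda>y. \<bar>g y\<bar>) summable_on B"
  shows "((\<lambda>(x, y). f x * g y) has_sum (a * b)) (A \<times> B)"
proof (rule has_sum_SigmaI)
  show "((\<lambda>y. case (x, y) of (x, y) \<Rightarrow> f x * g y) has_sum f x * b) B" for x
    using has_sum_cmult_right[OF g(1), of "f x"] by simp
  show "((\<lambda>x. f x * b) has_sum a * b) A"
    using f(1) by (rule has_sum_cmult_left)
  have "(\<lambda>(x, y). \<bar>f x\<bar> * \<bar>g y\<bar>) summable_on A \<times> B"
  proof (rule summable_on_SigmaI)
    show "((\<lambda>y. case (x, y) of (x, y) \<Rightarrow> \<bar>f x\<bar> * \<bar>g y\<bar>) has_sum \<bar>f x\<bar> * (\<Sum>\<^sub>\<infinity>y\<in>B. \<bar>g y\<bar>)) B" for x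
      using has_sum_cmult_right[OF has_sum_infsum[OF g(2)], of "\<bar>f x\<bar>"] by simp
    show "(\<lambda>x. \<bar>f x\<bar> * (\<Sum>\<^sub>\<infinity>y\<in>B. \<bar>g y\<bar>)) summable_on A"
      using f(2) by (rule summable_on_cmult_left)
  qed auto
  then have "(\<lambda>z. norm (case z of (x, y) \<Rightarrow> f x * g y)) summable_on A \<times> B"
    by (simp add: case_prod_unfold abs_mult)
  then show "(\<lambda>(x, y). f x * g y) summable_on A \<times> B"
    by (rule abs_summable_summable)
qed

text \<open>The map \<open>(i, j) \<mapsto> (i + j, i - j)\<close> is a bijection of the integer lattice onto the
sublattice of pairs with even sum.\<close>

lemma has_sum_rotate_lattice:
  fixes F :: "int \<times> int \<Rightarrow> real"
  assumes F: "(F has_sum s) UNIV" and odd: "\<And>m n. odd (m + n) \<Longrightarrow> F (m, n) = 0"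
  shows "((\<lambda>(i, j). F (i + j, i - j)) has_sum s) UNIV"
proof -
  define E where "E = {(m :: int, n :: int). even (m + n)}"
  have "(F has_sum s) E"
  proof -
    have "F p = 0" if "p \<notin> E" for p
      using that odd by (cases p) (simp add: E_def del: even_add)
    then show ?thesis using F by (subst has_sum_cong_neutral[of UNIV E F F s]) auto
  qed
  moreover have "bij_betw (\<lambda>(i, j). (i + j, i - j)) UNIV E"
  proof (rule bij_betwI[where g = "\<lambda>(m, n). ((m + n) div 2, (m - n) div 2)"])
    show "(\<lambda>(i, j). (i + j, i - j)) ((\<lambda>(m, n). ((m + n) div 2, (m - n) div 2)) y) = y"
      if "y \<in> E" for y
    proof -
      obtain m n where y: "y = (m, n)" by (cases y)
      with that have "even (m + n)" by (simp only: E_def mem_Collect_eq prod.case)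
      then obtain k where "m + n = 2 * k" by blast
      then have "m = 2 * k - n" by simp
      then show ?thesis by (simp add: y)
    qed
  qed (auto simp: E_def)
  ultimately have "((\<lambda>p. F (case p of (i, j) \<Rightarrow> (i + j, i - j))) has_sum s) UNIV"
    by (simp add: has_sum_reindex_bij_betw)
  then show ?thesis by (simp add: case_prod_unfold)
qed

definition theta3 :: "real \<Rightarrow> real" where
  "theta3 q = 1 + 2 * (\<Sum>n. q ^ (Suc n)\<^sup>2)"

definition theta4 :: "real \<Rightarrow> real" where
  "theta4 q = 1 + 2 * (\<Sum>n. (-1) ^ Suc n * q ^ (Suc n)\<^sup>2)"

definition theta_term :: "real \<Rightarrow> int \<Rightarrow> real" where
  "theta_term q m = q ^ nat (m\<^sup>2)"

definition alt_sign :: "int \<Rightarrow> real" where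
  "alt_sign m = (if even m then 1 else -1)"

lemma theta_term_of_nat: "theta_term q (int n) = q ^ n\<^sup>2"
  by (simp add: theta_term_def nat_power_eq)

lemma theta_term_0: "theta_term q 0 = 1"
  by (simp add: theta_term_def)

lemma alt_sign_of_nat: "alt_sign (int n) = (-1) ^ n"
  by (simp add: alt_sign_def)

lemma theta_term_rotate:
  "theta_term q (i + j) * theta_term q (i - j) = theta_term (q\<^sup>2) i * theta_term (q\<^sup>2) j"
proof -
  have "nat ((i + j)\<^sup>2) + nat ((i - j)\<^sup>2) = 2 * nat (i\<^sup>2) + 2 * nat (j\<^sup>2)"
  proof -
    have "int (nat ((i + j)\<^sup>2) + nat ((i - j)\<^sup>2)) = int (2 * nat (i\<^sup>2) + 2 * nat (j\<^sup>2))"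
    proof -
      have "(i + j)\<^sup>2 + (i - j)\<^sup>2 = 2 * i\<^sup>2 + 2 * j\<^sup>2" by algebra
      then show ?thesis by simp
    qed
    then show ?thesis by linarith
  qed
  then show ?thesis
    unfolding theta_term_def by (simp flip: power_add power_mult)
qed

context
  fixes q :: real
  assumes q: "0 < q" "q < 1"
begin

lemma square_powers_summable: "summable (\<lambda>n. q ^ (Suc n)\<^sup>2)"
proof (rule summable_comparison_test')
  show "summable (\<lambda>n. q ^ n)" using q by (simp add: summable_geometric)
  show "norm (q ^ (Suc n)\<^sup>2) \<le> q ^ n" for n
  proof -
    have "n \<le> (Suc n)\<^sup>2" by (simp add: power2_eq_square)
    then have "q ^ (Suc n)\<^sup>2 \<le> q ^ n" using q by (intro power_decreasing) auto
    then show ?thesis using q by simp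
  qed
qed

lemma alternating_square_powers_summable: "summable (\<lambda>n. (-1) ^ Suc n * q ^ (Suc n)\<^sup>2)"
proof (rule summable_norm_cancel)
  have "norm ((-1) ^ Suc n * q ^ (Suc n)\<^sup>2) = q ^ (Suc n)\<^sup>2" for n
    using q by (simp add: abs_mult power_abs del: power_Suc)
  with square_powers_summable show "summable (\<lambda>n. norm ((-1) ^ Suc n * q ^ (Suc n)\<^sup>2))"
    by (simp only:)
qed

lemma theta3_has_sum: "(theta_term q has_sum theta3 q) UNIV"
proof -
  have "(theta_term q has_sum (theta_term q 0 + 2 * (\<Sum>n. q ^ (Suc n)\<^sup>2))) UNIV"
  proof (rule even_has_sum_int)
    show "theta_term q (- m) = theta_term q m" for m by (simp add: theta_term_def)
    show "(\<lambda>n. theta_term q (int (Suc n))) sums (\<Sum>n. q ^ (Suc n)\<^sup>2)"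
      unfolding theta_term_of_nat using square_powers_summable by (rule summable_sums)
    have "\<bar>theta_term q (int (Suc n))\<bar> = q ^ (Suc n)\<^sup>2" for n
      unfolding theta_term_of_nat using q by (simp only: abs_of_nonneg zero_le_power less_imp_le)
    with square_powers_summable show "summable (\<lambda>n. \<bar>theta_term q (int (Suc n))\<bar>)"
      by (simp only:)
  qed
  then show ?thesis by (simp only: theta3_def theta_term_0)
qed

lemma theta4_has_sum: "((\<lambda>m. alt_sign m * theta_term q m) has_sum theta4 q) UNIV"
proof -
  let ?h = "\<lambda>m. alt_sign m * theta_term q m"
  have h: "?h (int (Suc n)) = (-1) ^ Suc n * q ^ (Suc n)\<^sup>2" for n
    by (simp only: alt_sign_of_nat theta_term_of_nat)
  have "(?h has_sum (?h 0 + 2 * (\<Sum>n. (-1) ^ Suc n * q ^ (Suc n)\<^sup>2))) UNIV"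
  proof (rule even_has_sum_int)
    show "?h (- m) = ?h m" for m by (simp add: theta_term_def alt_sign_def)
    show "(\<lambda>n. ?h (int (Suc n))) sums (\<Sum>n. (-1) ^ Suc n * q ^ (Suc n)\<^sup>2)"
      unfolding h using alternating_square_powers_summable by (rule summable_sums)
    have "\<bar>?h (int (Suc n))\<bar> = q ^ (Suc n)\<^sup>2" for n
      unfolding h using q by (simp only: abs_mult power_abs abs_minus_cancel abs_one power_one mult_1 abs_of_pos)
    with square_powers_summable show "summable (\<lambda>n. \<bar>?h (int (Suc n))\<bar>)"
      by (simp only:)
  qed
  moreover have "?h 0 = 1" by (simp add: theta_term_0 alt_sign_def)
  ultimately show ?thesis by (simp only: theta4_def)
qed

lemma theta_terms_abs_summable:
  "(\<lambda>m. \<bar>theta_term q m\<bar>) summable_on UNIV"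
  "(\<lambda>m. \<bar>alt_sign m * theta_term q m\<bar>) summable_on UNIV"
proof -
  have "theta_term q m \<ge> 0" "\<bar>alt_sign m\<bar> = 1" for m
    using q by (simp_all add: theta_term_def alt_sign_def)
  then have abs: "\<bar>theta_term q m\<bar> = theta_term q m" "\<bar>alt_sign m * theta_term q m\<bar> = theta_term q m" for m
    by (simp_all add: abs_mult)
  show "(\<lambda>m. \<bar>theta_term q m\<bar>) summable_on UNIV"
  "(\<lambda>m. \<bar>alt_sign m * theta_term q m\<bar>) summable_on UNIV"
    unfolding abs using has_sum_imp_summable[OF theta3_has_sum] by assumption+
qed

lemma theta_products_has_sum:
  shows "((\<lambda>(m, n). theta_term q m * theta_term q n) has_sum (theta3 q)\<^sup>2) UNIV"
    and "((\<lambda>(m, n). (alt_sign m * theta_term q m) * (alt_sign n * theta_term q n)) has_sum (theta4 q)\<^sup>2) UNIV"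
    and "((\<lambda>(m, n). theta_term q m * (alt_sign n * theta_term q n)) has_sum theta3 q * theta4 q) UNIV"
    and "((\<lambda>(m, n). (alt_sign m * theta_term q m) * theta_term q n) has_sum theta3 q * theta4 q) UNIV"
  using has_sum_product[OF theta3_has_sum theta_terms_abs_summable(1) theta3_has_sum theta_terms_abs_summable(1)]
    has_sum_product[OF theta4_has_sum theta_terms_abs_summable(2) theta4_has_sum theta_terms_abs_summable(2)]
    has_sum_product[OF theta3_has_sum theta_terms_abs_summable(1) theta4_has_sum theta_terms_abs_summable(2)]
    has_sum_product[OF theta4_has_sum theta_terms_abs_summable(2) theta3_has_sum theta_terms_abs_summable(1)]
  by (simp_all add: power2_eq_square mult.commute)

end

text \<open>In the double series of the left-hand side the pairs with odd sum cancel, and the others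
count twice; rotating them gives the double series of \<open>\<theta>\<^sub>3(q\<^sup>2)\<^sup>2\<close>.\<close>

lemma theta_sum_of_squares:
  assumes q: "0 < q" "q < 1"
  shows "(theta3 q)\<^sup>2 + (theta4 q)\<^sup>2 = 2 * (theta3 (q\<^sup>2))\<^sup>2"
proof -
  let ?F = "\<lambda>(m, n). (1 + alt_sign m * alt_sign n) * (theta_term q m * theta_term q n)"
  have q2: "0 < q\<^sup>2" "q\<^sup>2 < 1" using q by (auto simp: power_less_one_iff)
  have "(?F has_sum ((theta3 q)\<^sup>2 + (theta4 q)\<^sup>2)) UNIV"
    using has_sum_add[OF theta_products_has_sum(1,2)[OF q]]
    by (rule has_sum_cong[THEN iffD1, rotated]) (auto simp: algebra_simps)
  then have "((\<lambda>(i, j). ?F (i + j, i - j)) has_sum ((theta3 q)\<^sup>2 + (theta4 q)\<^sup>2)) UNIV"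
    by (rule has_sum_rotate_lattice) (auto simp: alt_sign_def)
  moreover have "?F (i + j, i - j) = 2 * (theta_term (q\<^sup>2) i * theta_term (q\<^sup>2) j)" for i j
    by (simp add: theta_term_rotate) (simp add: alt_sign_def)
  ultimately have "((\<lambda>(i, j). 2 * (theta_term (q\<^sup>2) i * theta_term (q\<^sup>2) j)) has_sum ((theta3 q)\<^sup>2 + (theta4 q)\<^sup>2)) UNIV"
    by simp
  moreover have "((\<lambda>(i, j). 2 * (theta_term (q\<^sup>2) i * theta_term (q\<^sup>2) j)) has_sum (2 * (theta3 (q\<^sup>2))\<^sup>2)) UNIV"
    using has_sum_cmult_right[OF theta_products_has_sum(1)[OF q2], of 2] by (simp add: case_prod_unfold)
  ultimately show ?thesis by (rule has_sum_unique)
qed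

text \<open>The product has two double series, with the sign on either variable. In their sum the
pairs with odd sum cancel, and rotating the others gives twice the double series of
\<open>\<theta>\<^sub>4(q\<^sup>2)\<^sup>2\<close>.\<close>

lemma theta_product:
  assumes q: "0 < q" "q < 1"
  shows "theta3 q * theta4 q = (theta4 (q\<^sup>2))\<^sup>2"
proof -
  let ?F = "\<lambda>(m, n). (alt_sign m + alt_sign n) * (theta_term q m * theta_term q n)"
  let ?G = "\<lambda>(i, j). 2 * ((alt_sign i * theta_term (q\<^sup>2) i) * (alt_sign j * theta_term (q\<^sup>2) j))"
  have q2: "0 < q\<^sup>2" "q\<^sup>2 < 1" using q by (auto simp: power_less_one_iff)
  have "(?F has_sum (theta3 q * theta4 q + theta3 q * theta4 q)) UNIV"
    using has_sum_add[OF theta_products_has_sum(3,4)[OF q]]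
    by (rule has_sum_cong[THEN iffD1, rotated]) (auto simp: algebra_simps)
  then have "((\<lambda>(i, j). ?F (i + j, i - j)) has_sum (theta3 q * theta4 q + theta3 q * theta4 q)) UNIV"
    by (rule has_sum_rotate_lattice) (auto simp: alt_sign_def)
  moreover have "?F (i + j, i - j) = ?G (i, j)" for i j
    by (simp add: theta_term_rotate) (simp add: alt_sign_def)
  ultimately have "(?G has_sum (theta3 q * theta4 q + theta3 q * theta4 q)) UNIV"
    by simp
  moreover have "(?G has_sum (2 * (theta4 (q\<^sup>2))\<^sup>2)) UNIV"
    using has_sum_cmult_right[OF theta_products_has_sum(2)[OF q2], of 2] by (simp add: case_prod_unfold)
  ultimately have "theta3 q * theta4 q + theta3 q * theta4 q = 2 * (theta4 (q\<^sup>2))\<^sup>2"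
    by (rule has_sum_unique)
  then show ?thesis by simp
qed

lemma theta4_eq_inverse_qbin:
  assumes q: "0 < q" "q < 1"
  shows "theta4 q = 1 / qbin q q"
proof -
  have "(\<lambda>n. \<Sum>k<n. (-1) ^ Suc k * q ^ (Suc k)\<^sup>2) \<longlonglongrightarrow> (\<Sum>n. (-1) ^ Suc n * q ^ (Suc n)\<^sup>2)"
    using alternating_square_powers_summable[OF q] by (rule summable_LIMSEQ)
  then have "(\<lambda>n. 1 + 2 * (\<Sum>k<n. (-1) ^ Suc k * q ^ (Suc k)\<^sup>2)) \<longlonglongrightarrow> theta4 q"
    unfolding theta4_def by (intro tendsto_intros)
  moreover have "(\<Sum>k<n. (-1) ^ Suc k * q ^ (Suc k)\<^sup>2) = (\<Sum>s = 1..n. (-1) ^ s * q ^ s\<^sup>2)" for n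
    by (simp only: sum.atLeast1_atMost_eq One_nat_def)
  ultimately show ?thesis
    using gauss_theta_limit[OF q] by (simp only: LIMSEQ_unique)
qed

text \<open>Positivity of \<open>\<theta>\<^sub>4\<close>, invisible in the alternating series, comes from the product. The bounds
with \<open>4 q\<close> fix the leading term of \<open>\<theta>\<^sub>3 - \<theta>\<^sub>4\<close>, which calibrates the nome below.\<close>

lemma theta_bounds:
  assumes q: "0 < q" "q < 1"
  shows "0 < theta4 q" "theta4 q \<le> theta3 q - 4 * q" "theta3 q - theta4 q \<le> 4 * q / (1 - q)"
    "1 \<le> theta3 q" "theta3 q \<le> 1 + 2 * q / (1 - q)"
proof -
  have "qbin q q \<ge> 1" using qbin_ge_1[OF q, of q] q by simp
  then show "0 < theta4 q" unfolding theta4_eq_inverse_qbin[OF q] by simp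
  let ?d = "\<lambda>n. (1 - (-1) ^ Suc n) * q ^ (Suc n)\<^sup>2"
  have "summable (\<lambda>n. q ^ (Suc n)\<^sup>2 - (-1) ^ Suc n * q ^ (Suc n)\<^sup>2)"
    by (intro summable_diff square_powers_summable alternating_square_powers_summable q)
  then have sd: "summable ?d" by (simp add: algebra_simps)
  have d: "theta3 q - theta4 q = 2 * (\<Sum>n. ?d n)"
    unfolding theta3_def theta4_def
    using suminf_diff[OF square_powers_summable alternating_square_powers_summable, OF q q]
    by (simp add: algebra_simps)
  have pow: "q ^ (Suc n)\<^sup>2 \<le> q ^ Suc n" for n
    using q by (intro power_decreasing) (auto simp: power2_eq_square)
  have geo: "(\<lambda>n. c * q ^ Suc n) sums (c * (q / (1 - q)))" for c
    using sums_mult[OF geometric_sums[of q], of "c * q"] q by (simp add: mult_ac)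
  have "(\<Sum>n<1. ?d n) \<le> (\<Sum>n. ?d n)"
    using sd by (rule sum_le_suminf) (use q in \<open>auto intro!: mult_nonneg_nonneg simp: minus_one_power_iff\<close>)
  then show "theta4 q \<le> theta3 q - 4 * q" using d by simp
  have "(\<Sum>n. ?d n) \<le> (\<Sum>n. 2 * q ^ Suc n)"
    using sd sums_summable[OF geo]
    by (intro suminf_le mult_mono pow) (use q in \<open>auto simp: minus_one_power_iff\<close>)
  also have "\<dots> = 2 * (q / (1 - q))" using geo by (rule sums_unique[symmetric])
  finally show "theta3 q - theta4 q \<le> 4 * q / (1 - q)" using d by simp
  have "0 \<le> (\<Sum>n. q ^ (Suc n)\<^sup>2)" using q by (intro suminf_nonneg square_powers_summable) auto
  then show "1 \<le> theta3 q" by (simp add: theta3_def)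
  have "(\<Sum>n. q ^ (Suc n)\<^sup>2) \<le> (\<Sum>n. 1 * q ^ Suc n)"
    using sums_summable[OF geo[of 1]] pow by (intro suminf_le square_powers_summable q) auto
  also have "\<dots> = 1 * (q / (1 - q))" using geo by (rule sums_unique[symmetric])
  finally show "theta3 q \<le> 1 + 2 * q / (1 - q)" by (simp add: theta3_def)
qed

section \<open>Inverting the nome\<close>

context
  fixes q :: real
  assumes q: "0 < q" "q < 1"
begin

lemma iterated_square_tendsto: "(\<lambda>n. q ^ 2 ^ n) \<longlonglongrightarrow> 0"
proof -
  have "filterlim (\<lambda>n::nat. (2::nat) ^ n) at_top sequentially"
    by (rule filterlim_subseq) (auto simp: strict_mono_def)
  moreover have "(\<lambda>n. q ^ n) \<longlonglongrightarrow> 0" using q by (intro LIMSEQ_power_zero) auto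
  ultimately show ?thesis by (rule filterlim_compose[rotated])
qed

lemma iterated_square_range: "0 < q ^ 2 ^ n" "q ^ 2 ^ n < 1"
  using q by (auto simp: power_less_one_iff)

lemma iterated_square_Suc: "q ^ 2 ^ Suc n = (q ^ 2 ^ n)\<^sup>2"
  by (simp only: power_Suc mult.commute[of 2] power_mult)

lemma theta_tendsto:
  "(\<lambda>n. theta3 (q ^ 2 ^ n)) \<longlonglongrightarrow> 1"
  "(\<lambda>n. theta4 (q ^ 2 ^ n)) \<longlonglongrightarrow> 1"
  "(\<lambda>n. (theta3 (q ^ 2 ^ n) - theta4 (q ^ 2 ^ n)) / q ^ 2 ^ n) \<longlonglongrightarrow> 4"
proof -
  note b = theta_bounds[OF iterated_square_range]
  note Q = iterated_square_tendsto iterated_square_range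
  have up3: "(\<lambda>n. 1 + 2 * q ^ 2 ^ n / (1 - q ^ 2 ^ n)) \<longlonglongrightarrow> 1 + 2 * 0 / (1 - 0)"
    by (intro tendsto_intros Q) auto
  show t3: "(\<lambda>n. theta3 (q ^ 2 ^ n)) \<longlonglongrightarrow> 1"
  proof (rule tendsto_sandwich[OF _ _ tendsto_const])
    show "eventually (\<lambda>n. 1 \<le> theta3 (q ^ 2 ^ n)) sequentially"
      using b(4) by (simp add: always_eventually)
    show "eventually (\<lambda>n. theta3 (q ^ 2 ^ n) \<le> 1 + 2 * q ^ 2 ^ n / (1 - q ^ 2 ^ n)) sequentially"
      using b(5) by (simp add: always_eventually)
    show "(\<lambda>n. 1 + 2 * q ^ 2 ^ n / (1 - q ^ 2 ^ n)) \<longlonglongrightarrow> 1" using up3 by simp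
  qed
  have up34: "(\<lambda>n. 4 / (1 - q ^ 2 ^ n)) \<longlonglongrightarrow> 4 / (1 - 0)"
    by (intro tendsto_intros Q) auto
  have le34: "4 \<le> (theta3 (q ^ 2 ^ n) - theta4 (q ^ 2 ^ n)) / q ^ 2 ^ n"
     "(theta3 (q ^ 2 ^ n) - theta4 (q ^ 2 ^ n)) / q ^ 2 ^ n \<le> 4 / (1 - q ^ 2 ^ n)" for n
  proof -
    show "4 \<le> (theta3 (q ^ 2 ^ n) - theta4 (q ^ 2 ^ n)) / q ^ 2 ^ n"
      using b(2)[of n] Q(2)[of n] by (simp add: le_divide_eq)
    have "(theta3 (q ^ 2 ^ n) - theta4 (q ^ 2 ^ n)) / q ^ 2 ^ n \<le> 4 * q ^ 2 ^ n / (1 - q ^ 2 ^ n) / q ^ 2 ^ n"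
      using b(3)[of n] Q(2)[of n] by (intro divide_right_mono) auto
    then show "(theta3 (q ^ 2 ^ n) - theta4 (q ^ 2 ^ n)) / q ^ 2 ^ n \<le> 4 / (1 - q ^ 2 ^ n)"
      using q by simp
  qed
  show t34: "(\<lambda>n. (theta3 (q ^ 2 ^ n) - theta4 (q ^ 2 ^ n)) / q ^ 2 ^ n) \<longlonglongrightarrow> 4"
  proof (rule tendsto_sandwich[OF _ _ tendsto_const])
    show "eventually (\<lambda>n. 4 \<le> (theta3 (q ^ 2 ^ n) - theta4 (q ^ 2 ^ n)) / q ^ 2 ^ n) sequentially"
      using le34(1) by (simp add: always_eventually)
    show "eventually (\<lambda>n. (theta3 (q ^ 2 ^ n) - theta4 (q ^ 2 ^ n)) / q ^ 2 ^ n \<le> 4 / (1 - q ^ 2 ^ n)) sequentially"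
      using le34(2) by (simp add: always_eventually)
    show "(\<lambda>n. 4 / (1 - q ^ 2 ^ n)) \<longlonglongrightarrow> 4" using up34 by simp
  qed
  have "(\<lambda>n. theta3 (q ^ 2 ^ n) - (theta3 (q ^ 2 ^ n) - theta4 (q ^ 2 ^ n)) / q ^ 2 ^ n * q ^ 2 ^ n) \<longlonglongrightarrow> 1 - 4 * 0"
    by (intro tendsto_intros t3 t34 Q)
  moreover have "theta3 (q ^ 2 ^ n) - (theta3 (q ^ 2 ^ n) - theta4 (q ^ 2 ^ n)) / q ^ 2 ^ n * q ^ 2 ^ n = theta4 (q ^ 2 ^ n)" for n
    using q by simp
  ultimately show "(\<lambda>n. theta4 (q ^ 2 ^ n)) \<longlonglongrightarrow> 1" by simp
qed

text \<open>The pair \<open>(\<theta>\<^sub>3\<^sup>2, \<theta>\<^sub>4\<^sup>2)\<close> performs the arithmetic-geometric iteration as \<open>q\<close> is squared, the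
integral is constant along it, and the pair tends to \<open>(1, 1)\<close>.\<close>

lemma gauss_integral_theta: "gauss_integral ((theta3 q)\<^sup>2) ((theta4 q)\<^sup>2) = pi / 2"
proof -
  let ?a = "\<lambda>n. (theta3 (q ^ 2 ^ n))\<^sup>2" and ?b = "\<lambda>n. (theta4 (q ^ 2 ^ n))\<^sup>2"
  note b = theta_bounds[OF iterated_square_range]
  have const: "gauss_integral (?a n) (?b n) = gauss_integral ((theta3 q)\<^sup>2) ((theta4 q)\<^sup>2)" for n
  proof (induction n)
    case (Suc n)
    let ?Q = "q ^ 2 ^ n"
    have "?a (Suc n) = (?a n + ?b n) / 2"
      unfolding iterated_square_Suc using theta_sum_of_squares[OF iterated_square_range[of n]] by simp
    moreover have "?b (Suc n) = sqrt (?a n * ?b n)"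
      unfolding iterated_square_Suc using theta_product[OF iterated_square_range[of n]] b(1,4)[of n]
      by (simp add: real_sqrt_mult)
    moreover have "0 < ?a n" "0 < ?b n" using b(1,4)[of n] by auto
    ultimately show ?case using Suc gauss_integral_landen[of "?a n" "?b n"] by (simp only:)
  qed simp
  have le: "pi / (2 * ?a n) \<le> gauss_integral ((theta3 q)\<^sup>2) ((theta4 q)\<^sup>2)"
       "gauss_integral ((theta3 q)\<^sup>2) ((theta4 q)\<^sup>2) \<le> pi / (2 * ?b n)" for n
  proof -
    have "?b n \<le> ?a n" using b(1,2)[of n] iterated_square_range(1)[of n] by (intro power_mono) auto
    moreover have "0 < ?b n" using b(1)[of n] by auto
    ultimately show "pi / (2 * ?a n) \<le> gauss_integral ((theta3 q)\<^sup>2) ((theta4 q)\<^sup>2)"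
       "gauss_integral ((theta3 q)\<^sup>2) ((theta4 q)\<^sup>2) \<le> pi / (2 * ?b n)"
      using gauss_integral_bounds[of "?b n" "?a n"] unfolding const by auto
  qed
  have "(\<lambda>n. pi / (2 * ?a n)) \<longlonglongrightarrow> pi / (2 * 1\<^sup>2)"
    by (intro tendsto_intros theta_tendsto) simp
  then have "pi / (2 * 1\<^sup>2) \<le> gauss_integral ((theta3 q)\<^sup>2) ((theta4 q)\<^sup>2)"
    by (rule LIMSEQ_le_const2) (use le(1) in blast)
  moreover have "(\<lambda>n. pi / (2 * ?b n)) \<longlonglongrightarrow> pi / (2 * 1\<^sup>2)"
    by (intro tendsto_intros theta_tendsto) simp
  then have "gauss_integral ((theta3 q)\<^sup>2) ((theta4 q)\<^sup>2) \<le> pi / (2 * 1\<^sup>2)"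
    by (rule LIMSEQ_le_const) (use le(2) in blast)
  ultimately show ?thesis by simp
qed

text \<open>Along the same iteration this integral doubles at every step. Its logarithmic estimate at
\<open>Q = q ^ 2 ^ n\<close> is governed by \<open>\<theta>\<^sub>3\<^sup>4 - \<theta>\<^sub>4\<^sup>4 \<sim> 16 Q\<close>, so after division by \<open>2 ^ n\<close> only
\<open>- ln q / 2\<close> survives; any constant factor in the asymptotics is washed out.\<close>

lemma gauss_integral_theta_complementary:
  "gauss_integral ((theta3 q)\<^sup>2) (sqrt (((theta3 q)\<^sup>2)\<^sup>2 - ((theta4 q)\<^sup>2)\<^sup>2)) = - ln q / 2"
proof -
  let ?Q = "\<lambda>n. q ^ 2 ^ n"
  define a where "a = (\<lambda>n. (theta3 (?Q n))\<^sup>2)"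
  define b where "b = (\<lambda>n. (theta4 (?Q n))\<^sup>2)"
  define J where "J = (\<lambda>n. gauss_integral (a n) (sqrt ((a n)\<^sup>2 - (b n)\<^sup>2)))"
  define L where "L = (\<lambda>n. arsinh (b n / sqrt ((a n)\<^sup>2 - (b n)\<^sup>2)) / b n / 2 ^ n)"
  note bd = theta_bounds[OF iterated_square_range]
  have b_pos: "0 < b n" for n using bd(1)[of n] by (simp add: b_def)
  have ab: "b n < a n" for n
    unfolding a_def b_def using bd(1,2)[of n] iterated_square_range(1)[of n]
    by (intro power_strict_mono) auto
  have J_Suc: "J (Suc n) = 2 * J n" for n
  proof -
    have a': "a (Suc n) = (a n + b n) / 2"
      unfolding a_def b_def iterated_square_Suc using theta_sum_of_squares[OF iterated_square_range[of n]] by simp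
    have "(b (Suc n))\<^sup>2 = a n * b n"
      unfolding a_def b_def iterated_square_Suc theta_product[OF iterated_square_range[of n], symmetric] by algebra
    then have "(a (Suc n))\<^sup>2 - (b (Suc n))\<^sup>2 = ((a n - b n) / 2)\<^sup>2"
      unfolding a' by (simp add: power2_eq_square field_simps)
    then have "sqrt ((a (Suc n))\<^sup>2 - (b (Suc n))\<^sup>2) = (a n - b n) / 2" using ab[of n] by simp
    then show ?thesis
      unfolding J_def using gauss_integral_complementary[OF b_pos ab, of n] a' by (simp only:)
  qed
  have J: "J n = 2 ^ n * J 0" for n
    by (induction n) (simp_all add: J_Suc)
  have bounds: "L n \<le> J 0" "J 0 \<le> L n + pi / (2 * b n) * (1 / 2) ^ n" for n
  proof -
    have "L n * 2 ^ n \<le> J n" and up: "J n \<le> L n * 2 ^ n + pi / (2 * b n)"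
      using gauss_integral_log_bounds[OF b_pos ab, of n] by (simp_all add: L_def J_def)
    then show "L n \<le> J 0" unfolding J[of n] by simp
    have "J 0 = J n / 2 ^ n" unfolding J[of n] by simp
    also have "\<dots> \<le> (L n * 2 ^ n + pi / (2 * b n)) / 2 ^ n" using up by (intro divide_right_mono) auto
    also have "\<dots> = L n + pi / (2 * b n) * (1 / 2) ^ n" by (simp add: add_divide_distrib power_one_over)
    finally show "J 0 \<le> L n + pi / (2 * b n) * (1 / 2) ^ n" .
  qed
  \<comment> \<open>\<open>arsinh (b / c) = ln ((a + b) / c)\<close> with \<open>c\<^sup>2 = (a + b) (a - b)\<close>, and \<open>a - b\<close> is compared with
      \<open>Q = q ^ 2 ^ n\<close>, to which it is asymptotically proportional.\<close>
  have L: "L n = ((1 / 2) ^ n * (ln (a n + b n) - ln ((a n - b n) / ?Q n)) - ln q) / (2 * b n)" for n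
  proof -
    define c where "c = sqrt ((a n)\<^sup>2 - (b n)\<^sup>2)"
    have "(b n)\<^sup>2 < (a n)\<^sup>2" using ab[of n] b_pos[of n] by (intro power_strict_mono) auto
    then have c2: "c\<^sup>2 = (a n)\<^sup>2 - (b n)\<^sup>2" and c: "c > 0" by (simp_all add: c_def)
    have "(b n / c)\<^sup>2 + 1 = (a n / c)\<^sup>2" using c c2 by (simp add: field_simps)
    then have "sqrt ((b n / c)\<^sup>2 + 1) = a n / c" using c ab[of n] b_pos[of n] by simp
    then have "arsinh (b n / c) = ln ((a n + b n) / c)"
      by (simp add: arsinh_real_def add_divide_distrib add.commute)
    also have "\<dots> = ln (a n + b n) - ln (c\<^sup>2) / 2"
      using c ab[of n] b_pos[of n] by (simp add: ln_div ln_realpow)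
    also have "c\<^sup>2 = (a n + b n) * (a n - b n)" unfolding c2 by algebra
    also have "ln ((a n + b n) * (a n - b n)) = ln (a n + b n) + ln (a n - b n)"
      using ab[of n] b_pos[of n] by (intro ln_mult_pos) auto
    also have "ln (a n - b n) = ln ((a n - b n) / ?Q n) + 2 ^ n * ln q"
      using ab[of n] q by (simp add: ln_div ln_realpow)
    finally have "arsinh (b n / c) / b n / 2 ^ n =
        (ln (a n + b n) - (ln (a n + b n) + (ln ((a n - b n) / ?Q n) + 2 ^ n * ln q)) / 2) / b n / 2 ^ n"
      by simp
    then show ?thesis unfolding L_def c_def[symmetric] using b_pos[of n]
      by (simp add: field_simps power_divide)
  qed
  have lima: "a \<longlonglongrightarrow> 1\<^sup>2" and limb: "b \<longlonglongrightarrow> 1\<^sup>2"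
    unfolding a_def b_def by (intro tendsto_intros theta_tendsto)+
  have half: "(\<lambda>n. (1 / 2) ^ n :: real) \<longlonglongrightarrow> 0" by (intro LIMSEQ_power_zero) simp
  have limd: "(\<lambda>n. (a n - b n) / ?Q n) \<longlonglongrightarrow> 4 * (1 + 1)"
  proof -
    have "(\<lambda>n. (theta3 (?Q n) - theta4 (?Q n)) / ?Q n * (theta3 (?Q n) + theta4 (?Q n))) \<longlonglongrightarrow> 4 * (1 + 1)"
      by (intro tendsto_intros theta_tendsto)
    moreover have "(theta3 (?Q n) - theta4 (?Q n)) / ?Q n * (theta3 (?Q n) + theta4 (?Q n)) = (a n - b n) / ?Q n" for n
      by (simp add: a_def b_def power2_eq_square algebra_simps)
    ultimately show ?thesis by (simp only:)
  qed
  have "L \<longlonglongrightarrow> (0 * (ln (1\<^sup>2 + 1\<^sup>2) - ln (4 * (1 + 1))) - ln q) / (2 * 1\<^sup>2)"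
    unfolding L by (intro tendsto_intros lima limb limd half) auto
  then have limL: "L \<longlonglongrightarrow> - ln q / 2" by simp
  have "(\<lambda>n. L n + pi / (2 * b n) * (1 / 2) ^ n) \<longlonglongrightarrow> - ln q / 2 + pi / (2 * 1\<^sup>2) * 0"
    by (intro tendsto_intros limL limb half) auto
  then have "J 0 \<le> - ln q / 2 + pi / (2 * 1\<^sup>2) * 0"
    by (rule LIMSEQ_le_const) (use bounds in auto)
  moreover have "- ln q / 2 \<le> J 0"
    using limL by (rule LIMSEQ_le_const2) (use bounds in auto)
  ultimately have "J 0 = - ln q / 2" by simp
  then show ?thesis by (simp add: J_def a_def b_def)
qed

end

text \<open>The modulus \<open>l\<close> with complement \<open>\<theta>\<^sub>4\<^sup>2 / \<theta>\<^sub>3\<^sup>2\<close> has the required period ratio, hence \<open>l = k\<close>;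
for \<open>l\<close> both \<open>K\<close> and the complementary modulus are known.\<close>

lemma theta4_modulus:
  assumes "r > 0" "q = exp (- pi * sqrt r)" "0 < k" "k < 1"
    and "ellK (sqrt (1 - k\<^sup>2)) / ellK k = sqrt r"
  shows "pi / (2 * sqrt (1 - k\<^sup>2) * ellK k) = 1 / (theta4 q)\<^sup>2"
proof -
  have q: "0 < q" "q < 1" using assms(1,2) by auto
  define a where "a = (theta3 q)\<^sup>2"
  define b where "b = (theta4 q)\<^sup>2"
  define l where "l = sqrt (1 - (b / a)\<^sup>2)"
  note bd = theta_bounds[OF q]
  have b: "0 < b" and ab: "b < a"
    unfolding a_def b_def using bd(1,2) q by (auto intro!: power_strict_mono)
  have "b / a < 1" "0 < b / a" using b ab by simp_all
  then have ba: "0 < (b / a)\<^sup>2" "(b / a)\<^sup>2 < 1" using b ab by (simp_all add: abs_square_less_1 del: zero_less_divide_iff)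
  then have l: "0 < l" "l < 1" by (simp_all add: l_def)
  have "1 - l\<^sup>2 = (b / a)\<^sup>2" using ba by (simp add: l_def)
  then have l': "sqrt (1 - l\<^sup>2) = b / a"
    using \<open>0 < b / a\<close> by (simp only: real_sqrt_abs abs_of_pos)
  have "l\<^sup>2 \<le> 1" using l by (simp add: abs_square_le_1)
  have Kl: "ellK l = a * pi / 2"
  proof -
    have "ellK l = gauss_integral 1 (b / a)"
      using ellK_eq_gauss_integral[OF \<open>l\<^sup>2 \<le> 1\<close>] l' by simp
    also have "\<dots> = gauss_integral (a * 1) (a * (b / a)) * a"
      using gauss_integral_scale[of a 1 "b / a"] b ab by simp
    also have "\<dots> = a * pi / 2"
      using gauss_integral_theta[OF q] b ab by (simp add: a_def b_def)
    finally show ?thesis .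
  qed
  have Kl': "ellK (sqrt (1 - l\<^sup>2)) = a * (pi * sqrt r / 2)"
  proof -
    have "ellK (sqrt (1 - l\<^sup>2)) = gauss_integral 1 l"
      unfolding l' using ellK_eq_gauss_integral[of "b / a"] ba by (simp only: l_def less_imp_le)
    also have "\<dots> = gauss_integral (a * 1) (a * l) * a"
      using gauss_integral_scale[of a 1 l] b ab by simp
    also have "a * l = sqrt (a\<^sup>2 - b\<^sup>2)"
    proof -
      have "a * l = sqrt (a\<^sup>2 * (1 - (b / a)\<^sup>2))" using b ab by (simp add: l_def real_sqrt_mult)
      also have "a\<^sup>2 * (1 - (b / a)\<^sup>2) = a\<^sup>2 - b\<^sup>2" using b ab by (simp add: field_simps)
      finally show ?thesis .
    qed
    also have "gauss_integral (a * 1) (sqrt (a\<^sup>2 - b\<^sup>2)) = - ln q / 2"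
      using gauss_integral_theta_complementary[OF q] by (simp add: a_def b_def)
    also have "- ln q / 2 * a = a * (pi * sqrt r / 2)" by (simp add: assms(2))
    finally show ?thesis .
  qed
  have "k = l"
  proof (rule ellK_ratio_determines_modulus)
    show "ellK (sqrt (1 - k\<^sup>2)) / ellK k = ellK (sqrt (1 - l\<^sup>2)) / ellK l"
      unfolding assms(5) Kl Kl' using b ab by simp
  qed (use assms l in auto)
  have "pi / (2 * sqrt (1 - k\<^sup>2) * ellK k) = pi / (2 * (b / a) * (a * pi / 2))"
    unfolding \<open>k = l\<close> l' Kl ..
  also have "\<dots> = 1 / b" using b ab by simp
  finally show ?thesis by (simp add: b_def)
qed

theorem proposition8:
  fixes \<nu> :: nat and r q k k' :: real
  assumes "\<nu> \<ge> 1"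
    and "r > 0"
    and "q = exp (- pi * sqrt r)"
    and "0 < k" and "k < 1"
    and "ellK (sqrt (1 - k\<^sup>2)) / ellK k = sqrt r"
    and "k' = sqrt (1 - k\<^sup>2)"
  shows "cf_has_value (part_num \<nu> q) (part_den q)
           (pi / (2 * k' * ellK k) * exp (- 4 * (\<Sum>j = 1..<\<nu>. artanh (q ^ j))))"
proof -
  have q: "0 < q" "q < 1" using assms(2,3) by auto
  have "(qbin q (q ^ \<nu>))\<^sup>2 = (qbin q q)\<^sup>2 * exp (- 4 * (\<Sum>j = 1..<\<nu>. artanh (q ^ j)))"
    using q assms(1) by (rule qbin_power_eq_exp)
  also have "(qbin q q)\<^sup>2 = 1 / (theta4 q)\<^sup>2"
    by (simp add: theta4_eq_inverse_qbin[OF q] power_divide)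
  also have "\<dots> = pi / (2 * k' * ellK k)"
    using theta4_modulus[OF assms(2-6)] assms(7) by simp
  finally show ?thesis using continued_fraction_value[OF q assms(1)] by simp
qed

end
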